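(* Every non-tubular (umbilic-free) channel linear Weingarten surface in a space form is a rotational surface. That is, if $\mathfrak{f}:\Sigma^2\to\mathfrak{R}_{\mathfrak{p},\mathfrak{q}}$ is a non-tubular channel linear Weingarten surface, then there is a $2$-plane $\Pi\perp\langle\mathfrak{p},\mathfrak{q}\rangle$ in $\mathbb{R}^{4,2}$ such that $\mathfrak{f}$ is invariant under a subgroup of rotations in $\Pi$.
   Context: $\mathbb{R}^{4,2}$ is a $6$-dimensional real vector space with inner product $(\cdot,\cdot)$ of signature $(-++++-)$, and $L^5$ its light cone. Let $\mathfrak{p}$ be unit timelike, $(\mathfrak{p},\mathfrak{p})=-1$ (point sphere complex), and $\mathfrak{q}\neq 0$, $\mathfrak{q}\perp\mathfrak{p}$ (space form vector), $\kappa=-(\mathfrak{q},\mathfrak{q})$. Then $\mathfrak{R}_{\mathfrak{p},\mathfrak{q}}=\{x\in L^5:(x,\mathfrak{p})=0,(x,\mathfrak{q})=-1\}$ has constant curvature $\kappa$ and (each connected component) models a $3$-dimensional space form. Points of the Lie quadric $\mathcal{L}=\{\langle v\rangle: v\ne0,(v,v)=0\}$ represent oriented spheres. Isometries of the space form are the orthogonal transformations of $\mathbb{R}^{4,2}$ fixing $\mathfrak{p}$ and $\mathfrak{q}$. For a surface $\mathfrak{f}:\Sigma^2\to\mathfrak{R}_{\mathfrak{p},\mathfrak{q}}$ with tangent plane congruence $\mathfrak{t}$ ($\mathfrak t\in L^5$, $(\mathfrak{t},\mathfrak{p})=-1$, $(\mathfrak{t},\mathfrak{q})=0$, $(\mathfrak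 f,\mathfrak t)=(d\mathfrak f,\mathfrak t)=0$), the Legendre lift is the null line congruence $\Lambda=\langle\mathfrak{f},\mathfrak{t}\rangle$. $\Lambda$ envelops a sphere congruence $\langle\mathfrak{s}\rangle:\Sigma^2\to\mathcal{L}$ if $\mathfrak{s}(p)\in\Lambda(p)$ for all $p$. $\mathfrak{f}$ is a channel surface if $\Lambda$ envelops a $1$-parameter family of spheres. With principal curvatures $k_1,k_2$, $K=k_1k_2$ is the (extrinsic) Gauss curvature and $H=\frac{k_1+k_2}{2}$ the mean curvature. $\mathfrak{f}$ is linear Weingarten if $aK+2bH+c=0$ for some non-trivial triple of real constants $a,b,c$; it is tubular if $ac-b^2=0$, that is, if one of the principal curvatures is constant. For a $2$-plane $\Pi\perp\langle\mathfrak{p},\mathfrak{q}\rangle$, a $1$-parameter subgroup of isometries is called a subgroup of rotations in $\Pi$ if it acts as the identity on $\Pi^\perp$. It is elliptic, parabolic, or hyperbolic according to whether the induced metric on $\Pi$ has signature $(++)$, $(+0)$, or $(+-)$. A surface $\mathfrak{f}$ is rotational if it is invariant under a subgroup of rotations in some such plane $\Pi$.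
   Formalization: The surface is assumed connected (two catenoid pieces with different axes would be a counterexample), and invariance under the rotations means local invariance: small rotations move a neighbourhood of each point within the surface, since a small patch is not mapped to itself. *)

theory Defs
  imports "HOL-Analysis.Analysis"
begin

section \<open>The space \<open>\<real>\<^sup>4\<^sup>,\<^sup>2\<close> and space forms\<close>

definition lie_inner :: "real^6 \<Rightarrow> real^6 \<Rightarrow> real" where
  "lie_inner x y =
     - (x$1 * y$1) + x$2 * y$2 + x$3 * y$3 + x$4 * y$4 + x$5 * y$5 - x$6 * y$6"

definition lie_perp :: "(real^6) set \<Rightarrow> (real^6) set" where
  "lie_perp S = {x. \<forall>y\<in>S. lie_inner x y = 0}"

definition light_cone :: "(real^6) set" where
  "light_cone = {x. lie_inner x x = 0}"

definition point_sphere_complex :: "real^6 \<Rightarrow> bool" where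
  "point_sphere_complex p \<longleftrightarrow> lie_inner p p = -1"

definition space_form_vector :: "real^6 \<Rightarrow> real^6 \<Rightarrow> bool" where
  "space_form_vector p q \<longleftrightarrow> q \<noteq> 0 \<and> lie_inner q p = 0"

definition space_form :: "real^6 \<Rightarrow> real^6 \<Rightarrow> (real^6) set" where
  "space_form p q = {x \<in> light_cone. lie_inner x p = 0 \<and> lie_inner x q = -1}"

definition space_form_isometry :: "real^6 \<Rightarrow> real^6 \<Rightarrow> (real^6 \<Rightarrow> real^6) \<Rightarrow> bool" where
  "space_form_isometry p q T \<longleftrightarrow>
     linear T \<and> (\<forall>x y. lie_inner (T x) (T y) = lie_inner x y) \<and> T p = p \<and> T q = q"

section \<open>Smooth maps and smooth surfaces\<close>

text \<open>\<open>Ck_on k f S\<close>: \<open>f\<close> is \<open>k\<close> times continuously differentiable on the open set \<open>S\<close>.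
  All iterated directional derivatives up to order \<open>k\<close> are required to exist as
  Frechet derivatives and to be continuous.\<close>

primrec Ck_on ::
    "nat \<Rightarrow> ('a::real_normed_vector \<Rightarrow> 'b::real_normed_vector) \<Rightarrow> 'a set \<Rightarrow> bool" where
  "Ck_on 0 f S \<longleftrightarrow> continuous_on S f"
| "Ck_on (Suc k) f S \<longleftrightarrow>
     (\<forall>x\<in>S. f differentiable (at x)) \<and>
     (\<forall>v. Ck_on k (\<lambda>x. frechet_derivative f (at x) v) S)"

definition smooth_on :: "'a set \<Rightarrow> ('a::real_normed_vector \<Rightarrow> 'b::real_normed_vector) \<Rightarrow> bool" where
  "smooth_on S f \<longleftrightarrow> (\<forall>k. Ck_on k f S)"

text \<open>A smooth atlas on a topological space \<open>M\<close> is given by local parametrizations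
  \<open>\<phi> : D \<rightarrow> M\<close>, with \<open>D\<close> open in the plane, i.e. by the inverses of the usual charts.\<close>

type_synonym 'a param = "(real^2) set \<times> (real^2 \<Rightarrow> 'a)"

definition smooth_2_manifold :: "'a topology \<Rightarrow> 'a param set \<Rightarrow> bool" where
  "smooth_2_manifold M \<A> \<longleftrightarrow>
     Hausdorff_space M \<and> second_countable M \<and>
     (\<forall>(D, \<phi>)\<in>\<A>. open D \<and> openin M (\<phi> ` D) \<and>
        homeomorphic_map (top_of_set D) (subtopology M (\<phi> ` D)) \<phi>) \<and>
     (\<Union>(D, \<phi>)\<in>\<A>. \<phi> ` D) = topspace M \<and>
     (\<forall>(D, \<phi>)\<in>\<A>. \<forall>(E, \<psi>)\<in>\<A>. smooth_on (D \<inter> \<phi> -` (\<psi> ` E)) (inv_into E \<psi> \<circ> \<phi>))"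

definition smooth_map :: "'a param set \<Rightarrow> ('a \<Rightarrow> 'b::real_normed_vector) \<Rightarrow> bool" where
  "smooth_map \<A> f \<longleftrightarrow> (\<forall>(D, \<phi>)\<in>\<A>. smooth_on D (f \<circ> \<phi>))"

definition immersion :: "'a param set \<Rightarrow> ('a \<Rightarrow> 'b::real_normed_vector) \<Rightarrow> bool" where
  "immersion \<A> f \<longleftrightarrow> smooth_map \<A> f \<and>
     (\<forall>(D, \<phi>)\<in>\<A>. \<forall>z\<in>D. inj (frechet_derivative (f \<circ> \<phi>) (at z)))"

definition surface_in_space_form ::
    "real^6 \<Rightarrow> real^6 \<Rightarrow> 'a topology \<Rightarrow> 'a param set \<Rightarrow> ('a \<Rightarrow> real^6) \<Rightarrow> bool" where
  "surface_in_space_form p q M \<A> f \<longleftrightarrow>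
     immersion \<A> f \<and> f ` topspace M \<subseteq> space_form p q"

definition tangent_plane_congruence ::
    "real^6 \<Rightarrow> real^6 \<Rightarrow> 'a topology \<Rightarrow> 'a param set \<Rightarrow> ('a \<Rightarrow> real^6) \<Rightarrow> ('a \<Rightarrow> real^6) \<Rightarrow> bool" where
  "tangent_plane_congruence p q M \<A> f t \<longleftrightarrow>
     smooth_map \<A> t \<and>
     (\<forall>x\<in>topspace M. t x \<in> light_cone \<and> lie_inner (t x) p = -1 \<and> lie_inner (t x) q = 0 \<and>
        lie_inner (f x) (t x) = 0) \<and>
     (\<forall>(D, \<phi>)\<in>\<A>. \<forall>z\<in>D. \<forall>v.
        lie_inner (frechet_derivative (f \<circ> \<phi>) (at z) v) (t (\<phi> z)) = 0)"

section \<open>Curvatures\<close>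

text \<open>For a local parametrization \<open>F\<close> of a surface with tangent plane congruence \<open>T\<close>, the
  vector \<open>N = T - p\<close> is the unit normal of \<open>F\<close> in the space form, so \<open>dT = dN\<close> and the
  shape operator \<open>A\<close> is given by \<open>dT = - dF \<circ> A\<close>. The predicate says that \<open>k1\<close>, \<open>k2\<close> are the
  eigenvalues of \<open>A\<close> at \<open>z\<close>, counted with multiplicity (\<open>k1 = k2\<close> exactly at an umbilic).\<close>

definition principal_curvatures ::
    "(real^2 \<Rightarrow> real^6) \<Rightarrow> (real^2 \<Rightarrow> real^6) \<Rightarrow> real^2 \<Rightarrow> real \<Rightarrow> real \<Rightarrow> bool" where
  "principal_curvatures F T z k1 k2 \<longleftrightarrow>
     (\<exists>v1 v2. v1 \<noteq> v2 \<and> independent {v1, v2} \<and>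
        frechet_derivative T (at z) v1 + k1 *\<^sub>R frechet_derivative F (at z) v1 = 0 \<and>
        frechet_derivative T (at z) v2 + k2 *\<^sub>R frechet_derivative F (at z) v2 = 0)"

definition gauss_curvature ::
    "(real^2 \<Rightarrow> real^6) \<Rightarrow> (real^2 \<Rightarrow> real^6) \<Rightarrow> real^2 \<Rightarrow> real" where
  "gauss_curvature F T z = (THE K. \<exists>k1 k2. principal_curvatures F T z k1 k2 \<and> K = k1 * k2)"

definition mean_curvature ::
    "(real^2 \<Rightarrow> real^6) \<Rightarrow> (real^2 \<Rightarrow> real^6) \<Rightarrow> real^2 \<Rightarrow> real" where
  "mean_curvature F T z = (THE H. \<exists>k1 k2. principal_curvatures F T z k1 k2 \<and> H = (k1 + k2) / 2)"

definition umbilic_free :: "'a param set \<Rightarrow> ('a \<Rightarrow> real^6) \<Rightarrow> ('a \<Rightarrow> real^6) \<Rightarrow> bool" where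
  "umbilic_free \<A> f t \<longleftrightarrow>
     (\<forall>(D, \<phi>)\<in>\<A>. \<forall>z\<in>D. \<not> (\<exists>k. principal_curvatures (f \<circ> \<phi>) (t \<circ> \<phi>) z k k))"

definition weingarten_relation ::
    "'a param set \<Rightarrow> ('a \<Rightarrow> real^6) \<Rightarrow> ('a \<Rightarrow> real^6) \<Rightarrow> real \<Rightarrow> real \<Rightarrow> real \<Rightarrow> bool" where
  "weingarten_relation \<A> f t a b c \<longleftrightarrow>
     (a, b, c) \<noteq> (0, 0, 0) \<and>
     (\<forall>(D, \<phi>)\<in>\<A>. \<forall>z\<in>D.
        a * gauss_curvature (f \<circ> \<phi>) (t \<circ> \<phi>) z + 2 * b * mean_curvature (f \<circ> \<phi>) (t \<circ> \<phi>) z + c = 0)"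

definition linear_weingarten :: "'a param set \<Rightarrow> ('a \<Rightarrow> real^6) \<Rightarrow> ('a \<Rightarrow> real^6) \<Rightarrow> bool" where
  "linear_weingarten \<A> f t \<longleftrightarrow> (\<exists>a b c. weingarten_relation \<A> f t a b c)"

text \<open>A surface with both principal curvatures constant satisfies several linear Weingarten
  relations; it counts as tubular, in accordance with the characterization of tubular
  surfaces by the constancy of one of the principal curvatures.\<close>

definition tubular :: "'a param set \<Rightarrow> ('a \<Rightarrow> real^6) \<Rightarrow> ('a \<Rightarrow> real^6) \<Rightarrow> bool" where
  "tubular \<A> f t \<longleftrightarrow> (\<exists>a b c. weingarten_relation \<A> f t a b c \<and> a * c - b\<^sup>2 = 0)"

section \<open>Channel surfaces\<close>

definition legendre_lift :: "('a \<Rightarrow> real^6) \<Rightarrow> ('a \<Rightarrow> real^6) \<Rightarrow> 'a \<Rightarrow> (real^6) set" where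
  "legendre_lift f t x = span {f x, t x}"

text \<open>A sphere congruence is represented by a nowhere vanishing null map \<open>s\<close>; only the lines
  \<open>\<langle>s x\<rangle> = span {s x}\<close> matter, so no regularity is imposed on the choice of representatives.\<close>

definition envelops ::
    "'a topology \<Rightarrow> ('a \<Rightarrow> (real^6) set) \<Rightarrow> ('a \<Rightarrow> real^6) \<Rightarrow> bool" where
  "envelops M \<Lambda> s \<longleftrightarrow> (\<forall>x\<in>topspace M. s x \<noteq> 0 \<and> s x \<in> light_cone \<and> s x \<in> \<Lambda> x)"

text \<open>The sphere congruence is a 1-parameter family: locally, \<open>\<langle>s\<rangle>\<close> factors through a smooth
  curve \<open>\<langle>\<sigma>\<rangle>\<close> of spheres via a smooth real parameter function \<open>u\<close>. The factorization is local
  since the space of leaves of a foliation need not be a (Hausdorff) 1-manifold globally.\<close>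

definition one_parameter_family :: "'a param set \<Rightarrow> ('a \<Rightarrow> real^6) \<Rightarrow> bool" where
  "one_parameter_family \<A> s \<longleftrightarrow>
     (\<forall>(D, \<phi>)\<in>\<A>. \<forall>z\<in>D. \<exists>U u J. \<exists>\<sigma> :: real \<Rightarrow> real^6.
        open U \<and> z \<in> U \<and> U \<subseteq> D \<and> smooth_on U u \<and>
        open J \<and> u ` U \<subseteq> J \<and> smooth_on J \<sigma> \<and>
        (\<forall>y\<in>U. span {s (\<phi> y)} = span {\<sigma> (u y)}))"

definition channel_surface ::
    "'a topology \<Rightarrow> 'a param set \<Rightarrow> ('a \<Rightarrow> real^6) \<Rightarrow> ('a \<Rightarrow> real^6) \<Rightarrow> bool" where
  "channel_surface M \<A> f t \<longleftrightarrow>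
     (\<exists>s. envelops M (legendre_lift f t) s \<and> one_parameter_family \<A> s)"

section \<open>Rotations\<close>

text \<open>A 1-parameter subgroup is non-trivial by definition; otherwise every surface would be
  invariant under one.\<close>

definition one_parameter_subgroup ::
    "real^6 \<Rightarrow> real^6 \<Rightarrow> (real \<Rightarrow> real^6 \<Rightarrow> real^6) \<Rightarrow> bool" where
  "one_parameter_subgroup p q \<rho> \<longleftrightarrow>
     (\<forall>\<tau>. space_form_isometry p q (\<rho> \<tau>)) \<and>
     \<rho> 0 = id \<and> (\<forall>\<tau> \<tau>'. \<rho> (\<tau> + \<tau>') = \<rho> \<tau> \<circ> \<rho> \<tau>') \<and>
     (\<forall>x. continuous_on UNIV (\<lambda>\<tau>. \<rho> \<tau> x)) \<and>
     (\<exists>\<tau>. \<rho> \<tau> \<noteq> id)"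

definition rotation_subgroup ::
    "real^6 \<Rightarrow> real^6 \<Rightarrow> (real^6) set \<Rightarrow> (real \<Rightarrow> real^6 \<Rightarrow> real^6) \<Rightarrow> bool" where
  "rotation_subgroup p q P \<rho> \<longleftrightarrow>
     one_parameter_subgroup p q \<rho> \<and> (\<forall>\<tau>. \<forall>x\<in>lie_perp P. \<rho> \<tau> x = x)"

text \<open>No completeness of the surface is assumed, and a proper piece of a surface of revolution is
  not mapped onto itself by the rotations. Invariance is therefore invariance under the local
  action: near each point, sufficiently small elements of the subgroup move the surface within
  itself. Requiring this for arbitrarily small neighbourhoods \<open>W\<close> makes sure that a sheet is
  moved within itself and not onto another sheet of the (possibly self-intersecting) surface.\<close>

definition invariant_under ::
    "'a topology \<Rightarrow> ('a \<Rightarrow> real^6) \<Rightarrow> (real \<Rightarrow> real^6 \<Rightarrow> real^6) \<Rightarrow> bool" where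
  "invariant_under M f \<rho> \<longleftrightarrow>
     (\<forall>W x. openin M W \<and> x \<in> W \<longrightarrow>
        (\<exists>U \<epsilon>. openin M U \<and> x \<in> U \<and> \<epsilon> > 0 \<and>
           (\<forall>\<tau>. \<bar>\<tau>\<bar> < \<epsilon> \<longrightarrow> \<rho> \<tau> ` f ` U \<subseteq> f ` W)))"

definition rotational_surface ::
    "real^6 \<Rightarrow> real^6 \<Rightarrow> 'a topology \<Rightarrow> ('a \<Rightarrow> real^6) \<Rightarrow> bool" where
  "rotational_surface p q M f \<longleftrightarrow>
     (\<exists>P \<rho>. subspace P \<and> dim P = 2 \<and> P \<subseteq> lie_perp (span {p, q}) \<and>
        rotation_subgroup p q P \<rho> \<and> invariant_under M f \<rho>)"

end

theory Submission
  imports Defs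
begin

text \<open>
  Why a non-tubular channel linear Weingarten surface is rotational. Let \<open>\<sigma>(u)\<close> be the
  \<open>1\<close>-parameter family of spheres, where \<open>u\<close> is a function on the surface. Writing
  \<open>\<sigma>(u) = \<alpha> f + \<beta> t\<close> and differentiating along a level curve of \<open>u\<close> gives
  \<open>\<alpha> df + \<beta> dt = 0\<close>: the level curves (called leaves below) are curvature lines with principal
  curvature \<open>k = \<alpha>/\<beta>\<close>, and \<open>k\<close> is constant along them. Since \<open>a c - b\<^sup>2\<close> does not vanish, the
  linear Weingarten equation can be solved for the other principal curvature \<open>l\<close>, so that \<open>l\<close> is a
  function of \<open>u\<close> as well.

  The contact conditions \<open>(f, \<sigma>) = (f, \<sigma>') = 0\<close> say that a leaf is a planar section of the light
  cone. One more derivative gives \<open>(f, \<sigma>'') = (\<sigma>', \<sigma>') / (\<beta> (l - k))\<close>, and the right-hand side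
  depends on \<open>u\<close> only, by the previous paragraph. This is the only place where the Weingarten equation is
  used: hence \<open>f\<close> has constant products with \<open>p\<close>, \<open>q\<close>, \<open>\<sigma>\<close>, \<open>\<sigma>'\<close> and \<open>\<sigma>''\<close> along a
  leaf, and the velocity and the acceleration of the leaf are orthogonal to all five of them. A
  dimension count then forces \<open>\<sigma>'' \<in> \<langle>p, q, \<sigma>, \<sigma>'\<rangle>\<close> (\<open>sphere2_eq\<close>). Therefore, for a fixed vector
  \<open>e\<close> orthogonal to \<open>p\<close> and \<open>q\<close>, the product \<open>(e, \<sigma>(u))\<close> solves a linear homogeneous ordinary
  differential equation of second order, and if \<open>e\<close> is orthogonal to \<open>\<sigma>\<close> and \<open>\<sigma>'\<close> at one value of
  \<open>u\<close>, then it is orthogonal to \<open>\<sigma>\<close> throughout (\<open>sphere_perp_propagates\<close>). So the plane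
  \<open>\<Pi> = \<langle>p, q, \<sigma>, \<sigma>'\<rangle>\<^sup>\<bottom>\<close> is locally constant, and by connectedness one plane \<open>\<Pi>\<close> is orthogonal to
  \<open>p\<close>, \<open>q\<close> and to every sphere of the family.

  For a basis \<open>e, v\<close> of \<open>\<Pi>\<close> the skew map \<open>X x = (x, v) e - (x, e) v\<close> generates the rotations in
  \<open>\<Pi>\<close>. At each point \<open>X f\<close> is orthogonal to \<open>p\<close>, \<open>q\<close>, \<open>f\<close> and, because \<open>t\<close> is a combination of
  \<open>\<sigma>\<close> and \<open>f\<close>, also to \<open>t\<close>; thus \<open>X f\<close> is tangent to the surface (\<open>skew_generator_tangent\<close>).
  Near a point the surface is the graph of a map \<open>H\<close> over its tangent plane, and an orbit of the
  rotations that starts on the surface stays on it for a short time, because its deviation from the graph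
  satisfies a Gronwall estimate (\<open>flow_preserves_tangential_image\<close>).
\<close>

section \<open>The inner product of \<open>\<real>\<^sup>4\<^sup>,\<^sup>2\<close> and contact elements\<close>

lemma exhaust_6:
  fixes i :: 6
  shows "i = 1 \<or> i = 2 \<or> i = 3 \<or> i = 4 \<or> i = 5 \<or> i = 6"
proof (induct i)
  case (of_int z)
  then have "z = 0 \<or> z = 1 \<or> z = 2 \<or> z = 3 \<or> z = 4 \<or> z = 5"
    by simp arith
  then show ?case
    by auto
qed

lemma vec6_eq_iff:
  "(x::real^6) = y \<longleftrightarrow> x$1 = y$1 \<and> x$2 = y$2 \<and> x$3 = y$3 \<and> x$4 = y$4 \<and> x$5 = y$5 \<and> x$6 = y$6"
proof (intro iffI)
  assume *: "x$1 = y$1 \<and> x$2 = y$2 \<and> x$3 = y$3 \<and> x$4 = y$4 \<and> x$5 = y$5 \<and> x$6 = y$6"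
  have "x $ i = y $ i" for i
    using exhaust_6[of i] * by (elim disjE) simp_all
  then show "x = y" by (simp add: vec_eq_iff)
qed simp

lemma bounded_bilinear_lie_inner: "bounded_bilinear lie_inner"
proof
  fix a b c :: "real^6" and r :: real
  show "lie_inner (a + b) c = lie_inner a c + lie_inner b c"
    "lie_inner c (a + b) = lie_inner c a + lie_inner c b"
    "lie_inner (r *\<^sub>R a) b = r *\<^sub>R lie_inner a b"
    "lie_inner a (r *\<^sub>R b) = r *\<^sub>R lie_inner a b"
    by (simp_all add: lie_inner_def algebra_simps)
next
  have "norm (lie_inner a b) \<le> norm a * norm b * 6" for a b :: "real^6"
  proof -
    have "\<bar>a$i * b$i\<bar> \<le> norm a * norm b" for i
      by (simp add: abs_mult component_le_norm_cart mult_mono)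
    from this[of 1] this[of 2] this[of 3] this[of 4] this[of 5] this[of 6]
    show ?thesis unfolding lie_inner_def real_norm_def by linarith
  qed
  then show "\<exists>K. \<forall>a b. norm (lie_inner a b) \<le> norm a * norm b * K" by blast
qed

interpretation lie: bounded_bilinear lie_inner
  by (rule bounded_bilinear_lie_inner)

lemmas lie_simps = lie.add_left lie.add_right lie.diff_left lie.diff_right
  lie.scaleR_left lie.scaleR_right lie.minus_left lie.minus_right lie.zero_left lie.zero_right

lemma lie_inner_commute: "lie_inner x y = lie_inner y x"
  by (simp add: lie_inner_def mult.commute)

lemma lie_inner_nondegenerate:
  assumes "\<And>y. lie_inner x y = 0"
  shows "x = 0"
proof -
  have "x $ i = 0" for i
    using assms[of "axis i 1"] exhaust_6[of i]
    by (auto simp: lie_inner_def axis_def)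
  then show ?thesis by (simp add: vec_eq_iff)
qed

text \<open>The linear map that sends \<open>c\<close> to \<open>\<Sum> c\<^sub>i b\<^sub>i\<close> is injective, hence onto, so a vector
  orthogonal to all \<open>b\<^sub>i\<close> is orthogonal to the whole space.\<close>

lemma orthogonal_to_basis_imp_zero:
  fixes b1 b2 b3 b4 b5 b6 x :: "real^6"
  assumes indep: "\<And>c1 c2 c3 c4 c5 c6.
      c1 *\<^sub>R b1 + c2 *\<^sub>R b2 + c3 *\<^sub>R b3 + c4 *\<^sub>R b4 + c5 *\<^sub>R b5 + c6 *\<^sub>R b6 = 0 \<Longrightarrow>
      c1 = 0 \<and> c2 = 0 \<and> c3 = 0 \<and> c4 = 0 \<and> c5 = 0 \<and> c6 = 0"
    and "lie_inner x b1 = 0" "lie_inner x b2 = 0" "lie_inner x b3 = 0"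
    "lie_inner x b4 = 0" "lie_inner x b5 = 0" "lie_inner x b6 = 0"
  shows "x = 0"
proof (rule lie_inner_nondegenerate)
  fix y
  let ?L = "\<lambda>c :: real^6. c$1 *\<^sub>R b1 + c$2 *\<^sub>R b2 + c$3 *\<^sub>R b3 + c$4 *\<^sub>R b4 + c$5 *\<^sub>R b5 + c$6 *\<^sub>R b6"
  have lin: "linear ?L"
    by (rule linearI) (simp_all add: algebra_simps)
  moreover have "inj ?L"
    unfolding linear_injective_0[OF lin]
  proof (intro allI impI)
    fix c :: "real^6" assume "?L c = 0"
    from indep[OF this] show "c = 0" by (simp add: vec6_eq_iff)
  qed
  ultimately have "surj ?L"
    by (rule linear_inj_imp_surj)
  then have "\<exists>c. y = ?L c" by (rule surjD)
  then obtain c where "y = ?L c" ..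
  then show "lie_inner x y = 0"
    using assms(2-) by (simp add: lie_simps)
qed

text \<open>The form has two negative directions. Both are used up by \<open>p\<close> and by a timelike vector \<open>y\<close> in the
  plane of \<open>f\<close> and \<open>q\<close>. If \<open>x\<close> were not spacelike, then \<open>p, y, x\<close> would span a three-dimensional
  negative semidefinite subspace, which must meet the positive definite subspace \<open>x\<^sub>1 = x\<^sub>6 = 0\<close>.\<close>

lemma lie_positive_definite_on_tangent:
  assumes p: "lie_inner p p = -1" "lie_inner q p = 0"
    and f: "lie_inner f f = 0" "lie_inner f p = 0" "lie_inner f q = -1"
    and x: "lie_inner x p = 0" "lie_inner x q = 0" "lie_inner x f = 0" "x \<noteq> 0"
  shows "lie_inner x x > 0"
proof (rule ccontr)
  assume neg: "\<not> lie_inner x x > 0"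
  obtain l where l: "l > 0" "l * lie_inner q q < 2"
  proof (cases "lie_inner q q \<le> 0")
    case True
    then show ?thesis using that[of 1] by simp
  next
    case False
    then show ?thesis using that[of "1 / lie_inner q q"] by simp
  qed
  define y where "y = f + l *\<^sub>R q"
  have "lie_inner y y = l * (l * lie_inner q q - 2)"
    using f by (simp add: y_def lie_simps lie_inner_commute[of q f] algebra_simps)
  then have yy: "lie_inner y y < 0"
    using l by (simp add: mult_pos_neg)
  have yp: "lie_inner y p = 0" and yx: "lie_inner y x = 0"
    using f p x by (simp_all add: y_def lie_simps lie_inner_commute[of q x] lie_inner_commute[of f x])
  \<comment> \<open>The cross product of the first and the sixth coordinates of \<open>p, y, x\<close> gives the
    coefficients of a combination that lies in \<open>x\<^sub>1 = x\<^sub>6 = 0\<close>.\<close>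
  define a where "a = y$1 * x$6 - y$6 * x$1"
  define b where "b = x$1 * p$6 - x$6 * p$1"
  define c where "c = p$1 * y$6 - p$6 * y$1"
  have neg_def: "r = 0 \<and> s = 0 \<and> t = 0"
    if "(r *\<^sub>R p + s *\<^sub>R y + t *\<^sub>R x)$1 = 0" "(r *\<^sub>R p + s *\<^sub>R y + t *\<^sub>R x)$6 = 0" for r s t
  proof -
    define z where "z = r *\<^sub>R p + s *\<^sub>R y + t *\<^sub>R x"
    have zz: "lie_inner z z = - r\<^sup>2 + s\<^sup>2 * lie_inner y y + t\<^sup>2 * lie_inner x x"
      using p x yp yx
      by (simp add: z_def lie_simps lie_inner_commute[of p y] lie_inner_commute[of p x] lie_inner_commute[of x y] power2_eq_square algebra_simps)
    have zpos: "lie_inner z z = (z$2)\<^sup>2 + (z$3)\<^sup>2 + (z$4)\<^sup>2 + (z$5)\<^sup>2"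
      using that by (simp add: z_def[symmetric] lie_inner_def power2_eq_square)
    have t1: "s\<^sup>2 * lie_inner y y \<le> 0" "t\<^sup>2 * lie_inner x x \<le> 0"
      using yy neg by (simp_all add: mult_nonneg_nonpos)
    have "r\<^sup>2 = 0" "s\<^sup>2 * lie_inner y y = 0"
      using zz zpos t1 zero_le_power2[of "z$2"] zero_le_power2[of "z$3"] zero_le_power2[of "z$4"]
        zero_le_power2[of "z$5"] zero_le_power2[of r] by linarith+
    then have rs: "r = 0" "s = 0" using yy by auto
    have "(z$2)\<^sup>2 = 0" "(z$3)\<^sup>2 = 0" "(z$4)\<^sup>2 = 0" "(z$5)\<^sup>2 = 0"
      using zz zpos t1 zero_le_power2[of "z$2"] zero_le_power2[of "z$3"] zero_le_power2[of "z$4"]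
        zero_le_power2[of "z$5"] zero_le_power2[of r] by linarith+
    then have "z = 0" using that by (simp add: z_def[symmetric] vec6_eq_iff)
    then show ?thesis using rs x by (simp add: z_def)
  qed
  have "a = 0 \<and> b = 0 \<and> c = 0"
    by (rule neg_def) (simp_all add: a_def b_def c_def algebra_simps)
  then have par: "y$1 * x$6 = y$6 * x$1" "x$1 * p$6 = x$6 * p$1"
    by (simp_all add: a_def b_def)
  have "p$1 = 0 \<and> p$6 = 0"
    using neg_def[of "x$1" 0 "- p$1"] neg_def[of "x$6" 0 "- p$6"] par by (simp add: algebra_simps)
  then show False using neg_def[of 1 0 0] by simp
qed

text \<open>A point \<open>f\<close> of the space form with a tangent plane \<open>t\<close>; the isotropic line through the two is the
  contact element.\<close>

locale contact_element =
  fixes p q f t :: "real^6"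
  assumes pp: "lie_inner p p = -1" and qp: "lie_inner q p = 0"
    and ff: "lie_inner f f = 0" and fp: "lie_inner f p = 0" and fq: "lie_inner f q = -1"
    and tt: "lie_inner t t = 0" and tp: "lie_inner t p = -1" and tq: "lie_inner t q = 0"
    and ft: "lie_inner f t = 0"
begin

lemmas contact_simps = pp qp ff fp fq tt tp tq ft
  lie_inner_commute[of p q] lie_inner_commute[of p f] lie_inner_commute[of q f]
  lie_inner_commute[of p t] lie_inner_commute[of q t] lie_inner_commute[of t f]

text \<open>The vectors \<open>p, q, f, t\<close> span a nondegenerate four-dimensional space, so its orthogonal
  complement is a plane and an injective map from the plane fills it.\<close>

lemma tangent_vectors_are_derivatives:
  fixes L :: "real^2 \<Rightarrow> real^6"
  assumes L: "linear L" "inj L"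
    and perp: "\<And>w. lie_inner (L w) p = 0" "\<And>w. lie_inner (L w) q = 0"
      "\<And>w. lie_inner (L w) f = 0" "\<And>w. lie_inner (L w) t = 0"
    and x: "lie_inner x p = 0" "lie_inner x q = 0" "lie_inner x f = 0" "lie_inner x t = 0"
  shows "\<exists>w. x = L w"
proof -
  let ?H = "\<lambda>c :: real^6. c$1 *\<^sub>R p + c$2 *\<^sub>R q + c$3 *\<^sub>R f + c$4 *\<^sub>R t + L (vector [c$5, c$6])"
  have lin: "linear ?H"
  proof (rule linearI)
    fix c d :: "real^6" and r :: real
    have "vector [(c + d)$5, (c + d)$6] = vector [c$5, c$6] + (vector [d$5, d$6] :: real^2)"
      by (simp add: vec_eq_iff forall_2)
    then show "?H (c + d) = ?H c + ?H d"
      using linear_add[OF L(1)] by (simp add: algebra_simps)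
    have "vector [(r *\<^sub>R c)$5, (r *\<^sub>R c)$6] = r *\<^sub>R (vector [c$5, c$6] :: real^2)"
      by (simp add: vec_eq_iff forall_2)
    then show "?H (r *\<^sub>R c) = r *\<^sub>R ?H c"
      using linear_scale[OF L(1)] by (simp add: algebra_simps)
  qed
  have zero: "c$1 = 0 \<and> c$2 = 0 \<and> c$3 = 0 \<and> c$4 = 0"
    if h: "\<And>y. y \<in> {p, q, f, t} \<Longrightarrow> lie_inner (?H c) y = 0" for c
  proof -
    have "lie_inner (?H c) f = - c$2" "lie_inner (?H c) t = - c$1"
      "lie_inner (?H c) p = - c$1 - c$4" "lie_inner (?H c) q = c$2 * lie_inner q q - c$3"
      by (simp_all add: lie_simps contact_simps perp)
    moreover have "lie_inner (?H c) f = 0" "lie_inner (?H c) t = 0"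
      "lie_inner (?H c) p = 0" "lie_inner (?H c) q = 0"
      by (rule h; simp)+
    ultimately have "c$2 = 0" "c$1 = 0" "- c$1 - c$4 = 0" "c$2 * lie_inner q q - c$3 = 0"
      by linarith+
    then show ?thesis by auto
  qed
  have "inj ?H"
  proof (rule linear_injective_0[OF lin, THEN iffD2], intro allI impI)
    fix c assume c: "?H c = 0"
    then have *: "c$1 = 0 \<and> c$2 = 0 \<and> c$3 = 0 \<and> c$4 = 0"
      by (intro zero) (simp add: lie_simps)
    with c have "L (vector [c$5, c$6]) = L 0" by (simp add: linear_0[OF L(1)])
    with L(2) have v: "vector [c$5, c$6] = (0 :: real^2)" by (rule injD)
    have "c$5 = 0" "c$6 = 0"
      using arg_cong[OF v, of "\<lambda>w. w$1"] arg_cong[OF v, of "\<lambda>w. w$2"] by simp_all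
    then show "c = 0" using * by (simp add: vec6_eq_iff)
  qed
  with lin have "surj ?H" by (rule linear_inj_imp_surj)
  then have "\<exists>c. x = ?H c" by (rule surjD)
  then obtain c where c: "x = ?H c" ..
  have "c$1 = 0 \<and> c$2 = 0 \<and> c$3 = 0 \<and> c$4 = 0"
    by (rule zero) (use x in \<open>auto simp flip: c\<close>)
  then show ?thesis using c by (intro exI[of _ "vector [c$5, c$6]"]) simp
qed

end

section \<open>Uniqueness for linear differential equations\<close>

text \<open>The factor \<open>exp (- L s)\<close>, or \<open>exp (L s)\<close> when \<open>x\<close> lies to the left of \<open>x0\<close>, makes \<open>g\<close> monotone
  in the direction in which it cannot become positive.\<close>

lemma gronwall_zero:
  fixes g g' :: "real \<Rightarrow> real"
  assumes der: "\<And>s. s \<in> closed_segment x0 x \<Longrightarrow> (g has_real_derivative g' s) (at s)"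
    and bound: "\<And>s. s \<in> closed_segment x0 x \<Longrightarrow> \<bar>g' s\<bar> \<le> L * g s"
    and nonneg: "g x \<ge> 0" and zero: "g x0 = 0"
  shows "g x = 0"
proof (cases "x0 \<le> x")
  case True
  have "\<exists>d. ((\<lambda>s. g s * exp (- L * s)) has_real_derivative d) (at s) \<and> d \<le> 0"
    if "x0 \<le> s" "s \<le> x" for s
  proof (intro exI conjI)
    have s: "s \<in> closed_segment x0 x" using that True by (simp add: closed_segment_eq_real_ivl)
    show "((\<lambda>s. g s * exp (- L * s)) has_real_derivative (g' s - L * g s) * exp (- L * s)) (at s)"
      by (auto intro!: derivative_eq_intros der[OF s] simp: algebra_simps)
    show "(g' s - L * g s) * exp (- L * s) \<le> 0"
      using bound[OF s] by (intro mult_nonpos_nonneg) auto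
  qed
  from DERIV_nonpos_imp_nonincreasing[OF True this] nonneg zero show ?thesis
    by (simp add: mult_le_0_iff)
next
  case False
  then have le: "x \<le> x0" by simp
  have "\<exists>d. ((\<lambda>s. g s * exp (L * s)) has_real_derivative d) (at s) \<and> d \<ge> 0"
    if "x \<le> s" "s \<le> x0" for s
  proof (intro exI conjI)
    have s: "s \<in> closed_segment x0 x" using that False by (simp add: closed_segment_eq_real_ivl)
    show "((\<lambda>s. g s * exp (L * s)) has_real_derivative (g' s + L * g s) * exp (L * s)) (at s)"
      by (auto intro!: derivative_eq_intros der[OF s] simp: algebra_simps)
    show "(g' s + L * g s) * exp (L * s) \<ge> 0"
      using bound[OF s] by (intro mult_nonneg_nonneg) auto
  qed
  from DERIV_nonneg_imp_nondecreasing[OF le this] nonneg zero show ?thesis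
    by (simp add: mult_le_0_iff)
qed

text \<open>The energy \<open>y\<^sup>2 + y'\<^sup>2\<close> satisfies the Gronwall estimate on every compact segment, where the
  coefficients are bounded.\<close>

lemma linear_second_order_ode_unique:
  fixes y y1 C E :: "real \<Rightarrow> real"
  assumes "connected I" "r0 \<in> I" "r \<in> I"
    and y: "\<And>s. s \<in> I \<Longrightarrow> (y has_real_derivative y1 s) (at s)"
    and y1: "\<And>s. s \<in> I \<Longrightarrow> (y1 has_real_derivative C s * y s + E s * y1 s) (at s)"
    and C: "continuous_on I C" and E: "continuous_on I E"
    and zero: "y r0 = 0" "y1 r0 = 0"
  shows "y r = 0"
proof -
  let ?S = "closed_segment r0 r"
  have sub: "?S \<subseteq> I"
    using assms(1-3)
        by (simp add: closed_segment_subset is_interval_connected_1 flip: is_interval_convex_1)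
  have "compact (C ` ?S)" "compact (E ` ?S)"
    using continuous_on_subset[OF C sub] continuous_on_subset[OF E sub]
    by (auto intro: compact_continuous_image)
  then obtain K1 K2 where K: "\<And>s. s \<in> ?S \<Longrightarrow> \<bar>C s\<bar> \<le> K1" "\<And>s. s \<in> ?S \<Longrightarrow> \<bar>E s\<bar> \<le> K2"
    by (metis bounded_iff compact_imp_bounded image_eqI real_norm_def)
  let ?g = "\<lambda>s. (y s)\<^sup>2 + (y1 s)\<^sup>2"
  let ?g' = "\<lambda>s. 2 * y s * y1 s + 2 * y1 s * (C s * y s + E s * y1 s)"
  have der: "(?g has_real_derivative ?g' s) (at s)" and bound: "\<bar>?g' s\<bar> \<le> (1 + K1 + 2 * K2) * ?g s"
    if s: "s \<in> ?S" for s
  proof -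
    from s sub have "s \<in> I" by blast
    then show "(?g has_real_derivative ?g' s) (at s)"
      by (auto intro!: derivative_eq_intros y y1 simp: algebra_simps)
    have amgm: "\<bar>y s * y1 s\<bar> * 2 \<le> ?g s"
      using sum_squares_bound[of "\<bar>y s\<bar>" "\<bar>y1 s\<bar>"] by (simp add: abs_mult)
    have nonneg: "0 \<le> K1" "0 \<le> K2"
      using K[OF s] by (meson abs_ge_zero order_trans)+
    have "?g' s = 2 * (y s * y1 s) + C s * (2 * (y s * y1 s)) + 2 * (E s * (y1 s)\<^sup>2)"
      by (simp add: algebra_simps power2_eq_square)
    also have "\<bar>\<dots>\<bar> \<le> \<bar>2 * (y s * y1 s)\<bar> + \<bar>C s * (2 * (y s * y1 s))\<bar> + 2 * \<bar>E s * (y1 s)\<^sup>2\<bar>"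
      by linarith
    also have "\<bar>C s * (2 * (y s * y1 s))\<bar> \<le> K1 * ?g s"
      unfolding abs_mult[of "C s"] using K[OF s] amgm nonneg by (intro mult_mono) (auto simp: abs_mult)
    also have "\<bar>E s * (y1 s)\<^sup>2\<bar> \<le> K2 * ?g s"
      unfolding abs_mult[of "E s"] using K[OF s] nonneg by (intro mult_mono) auto
    also have "\<bar>2 * (y s * y1 s)\<bar> \<le> ?g s"
      using amgm by (simp add: abs_mult)
    finally show "\<bar>?g' s\<bar> \<le> (1 + K1 + 2 * K2) * ?g s"
      by (simp add: algebra_simps)
  qed
  have "?g r = 0"
    using gronwall_zero[of r0 r ?g ?g', OF der bound] zero by simp
  then show ?thesis by (simp add: sum_power2_eq_zero_iff)
qed

section \<open>Smooth maps\<close>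

lemma smooth_on_subset: "smooth_on S f \<Longrightarrow> S' \<subseteq> S \<Longrightarrow> smooth_on S' f"
proof -
  have "Ck_on k f S \<Longrightarrow> S' \<subseteq> S \<Longrightarrow> Ck_on k f S'" for k
    by (induction k arbitrary: f) (auto intro: continuous_on_subset)
  then show "smooth_on S f \<Longrightarrow> S' \<subseteq> S \<Longrightarrow> smooth_on S' f"
    by (auto simp: smooth_on_def)
qed

lemma smooth_on_has_derivative:
  assumes "smooth_on S f" "x \<in> S"
  shows "(f has_derivative frechet_derivative f (at x)) (at x)"
proof -
  have "Ck_on (Suc 0) f S" using assms by (simp add: smooth_on_def del: Ck_on.simps)
  then show ?thesis using assms(2) by (simp add: frechet_derivative_works)
qed

lemma smooth_on_frechet_derivative:
  assumes "smooth_on S f"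
  shows "smooth_on S (\<lambda>x. frechet_derivative f (at x) v)"
  unfolding smooth_on_def
proof
  fix k
  have "Ck_on (Suc k) f S" using assms by (simp add: smooth_on_def del: Ck_on.simps)
  then show "Ck_on k (\<lambda>x. frechet_derivative f (at x) v) S" by simp
qed

lemma smooth_on_continuous_on: "smooth_on S f \<Longrightarrow> continuous_on S f"
  unfolding smooth_on_def by (metis Ck_on.simps(1))

lemma smooth_on_has_vector_derivative:
  fixes h :: "real \<Rightarrow> 'b::real_normed_vector"
  assumes "smooth_on S h" "r \<in> S"
  shows "(h has_vector_derivative frechet_derivative h (at r) 1) (at r)"
proof -
  have d: "(h has_derivative frechet_derivative h (at r)) (at r)"
    by (rule smooth_on_has_derivative[OF assms])
  have "frechet_derivative h (at r) x = x *\<^sub>R frechet_derivative h (at r) 1" for x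
    using linear_scale[OF has_derivative_linear[OF d], of x 1] by simp
  then have "frechet_derivative h (at r) = (\<lambda>x. x *\<^sub>R frechet_derivative h (at r) 1)"
    by (rule ext)
  with d show ?thesis by (simp add: has_vector_derivative_def)
qed

text \<open>The product rule in the form in which it is used throughout: a known value of \<open>(X, Y)\<close> on an open
  set gives a relation between the derivatives.\<close>

lemma differentiate_lie_inner:
  fixes X Y :: "'a::real_normed_vector \<Rightarrow> real^6"
  assumes "open U" "z \<in> U"
    and X: "(X has_derivative X') (at z)" and Y: "(Y has_derivative Y') (at z)"
    and m: "(m has_derivative m') (at z)"
    and eq: "\<And>y. y \<in> U \<Longrightarrow> lie_inner (X y) (Y y) = m y"
  shows "lie_inner (X' v) (Y z) + lie_inner (X z) (Y' v) = m' v"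
proof -
  have "((\<lambda>y. lie_inner (X y) (Y y)) has_derivative (\<lambda>v. lie_inner (X z) (Y' v)
      + lie_inner (X' v) (Y z))) (at z)"
    by (rule lie.FDERIV[OF X Y])
  moreover have "((\<lambda>y. lie_inner (X y) (Y y)) has_derivative m') (at z)"
    by (rule has_derivative_transform_within_open[OF m assms(1,2)]) (simp add: eq)
  ultimately have "(\<lambda>v. lie_inner (X z) (Y' v) + lie_inner (X' v) (Y z)) = m'"
    by (rule has_derivative_unique)
  from fun_cong[OF this, of v] show ?thesis by simp
qed

lemma has_derivative_curve_along:
  assumes "(h has_vector_derivative h') (at (u z))" "(u has_derivative u') (at z)"
  shows "((\<lambda>z. h (u z)) has_derivative (\<lambda>v. u' v *\<^sub>R h')) (at z)"
  using diff_chain_at[OF assms(2) assms(1)[unfolded has_vector_derivative_def]]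
  by (simp add: o_def)

section \<open>Linear algebra of the parameter plane\<close>

lemma independent_pair_coefficients:
  fixes v w :: "'a::real_vector"
  assumes vw: "independent {v, w}" "v \<noteq> w" and comb: "a *\<^sub>R v + b *\<^sub>R w = 0"
  shows "a = 0 \<and> b = 0"
proof -
  have w: "w \<noteq> 0" and v: "v \<notin> span {w}"
    using vw by (auto simp: independent_insert)
  have "a = 0"
  proof (rule ccontr)
    assume a: "a \<noteq> 0"
    have "a *\<^sub>R v = (- b) *\<^sub>R w" using comb by (simp add: eq_neg_iff_add_eq_0)
    then have "(1 / a) *\<^sub>R a *\<^sub>R v = (1 / a) *\<^sub>R (- b) *\<^sub>R w" by (rule arg_cong)
    then have "v = (- b / a) *\<^sub>R w" using a by simp
    then have "v \<in> span {w}" by (metis span_base span_scale insertI1)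
    with v show False ..
  qed
  with comb w show ?thesis by simp
qed

lemma in_span_pair:
  fixes x v w :: "'a::real_vector"
  assumes "x \<in> span {v, w}"
  shows "\<exists>c d. x = c *\<^sub>R v + d *\<^sub>R w"
proof -
  obtain c where "x - c *\<^sub>R v \<in> span {w}" using assms by (auto simp: span_breakdown_eq)
  then obtain d where "x - c *\<^sub>R v = d *\<^sub>R w" by (auto simp: span_singleton)
  then have "x = c *\<^sub>R v + d *\<^sub>R w" by (simp add: diff_eq_eq add.commute)
  then show ?thesis by blast
qed

lemma plane_eq_span_pair:
  fixes v w y :: "real^2"
  assumes "independent {v, w}" "v \<noteq> w"
  shows "\<exists>c d. y = c *\<^sub>R v + d *\<^sub>R w"
proof -
  have "UNIV \<subseteq> span {v, w}"
    by (rule card_ge_dim_independent) (use assms in auto)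
  then show ?thesis by (intro in_span_pair) blast
qed

lemma independent_axes: "independent {axis 1 1, axis 2 (1::real) :: real^2}"
    "axis 1 1 \<noteq> (axis 2 (1::real) :: real^2)"
proof -
  show "axis 1 1 \<noteq> (axis 2 (1::real) :: real^2)" by (simp add: axis_eq_axis)
  show "independent {axis 1 1, axis 2 (1::real) :: real^2}"
    by (rule independent_mono[OF independent_Basis]) (auto simp: Basis_vec_def)
qed

lemma rotated_eq_0: "r *\<^sub>R axis 2 1 - s *\<^sub>R axis 1 1 = (0 :: real^2) \<Longrightarrow> r = 0 \<and> s = 0"
  by (simp add: vec_eq_iff forall_2 axis_def)

section \<open>Principal curvatures\<close>

text \<open>Two independent eigenvectors with distinct eigenvalues leave no room for further eigenvectors. The
  curvatures are defined by descriptions, so this is what makes them computable.\<close>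

lemma principal_curvatures_eigenvalue:
  fixes F T :: "real^2 \<Rightarrow> real^6"
  assumes F: "(F has_derivative F') (at z)" and T: "(T has_derivative T') (at z)"
    and inj: "inj F'"
    and vw: "independent {v, w}" "v \<noteq> w"
    and v: "T' v + k1 *\<^sub>R F' v = 0" and w: "T' w + k2 *\<^sub>R F' w = 0"
    and "k1 \<noteq> k2" and x: "T' x + l *\<^sub>R F' x = 0" "x \<noteq> 0"
  shows "(l = k1 \<and> x \<in> span {v}) \<or> (l = k2 \<and> x \<in> span {w})"
proof -
  note lF = has_derivative_linear[OF F] and lT = has_derivative_linear[OF T]
  obtain c d where cd: "x = c *\<^sub>R v + d *\<^sub>R w" using plane_eq_span_pair[OF vw] by blast
  have "T' v = - k1 *\<^sub>R F' v" "T' w = - k2 *\<^sub>R F' w"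
    using v w by (simp_all add: eq_neg_iff_add_eq_0)
  then have "F' ((c * (l - k1)) *\<^sub>R v + (d * (l - k2)) *\<^sub>R w) = T' x + l *\<^sub>R F' x"
    unfolding cd by (simp add: linear_add[OF lF] linear_add[OF lT] linear_scale[OF lF] linear_scale[OF lT]
        linear_diff[OF lF] algebra_simps)
  also have "\<dots> = F' 0" using x linear_0[OF lF] by simp
  finally have comb: "(c * (l - k1)) *\<^sub>R v + (d * (l - k2)) *\<^sub>R w = 0"
    using inj by (simp add: inj_eq)
  have "c * (l - k1) = 0 \<and> d * (l - k2) = 0"
    by (rule independent_pair_coefficients[OF vw comb])
  then have "c = 0 \<or> l = k1" "d = 0 \<or> l = k2" by auto
  with \<open>k1 \<noteq> k2\<close> x(2) cd show ?thesis by (auto simp: span_singleton)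
qed

lemma distinct_principal_curvatures_unique:
  fixes F T :: "real^2 \<Rightarrow> real^6"
  assumes F: "(F has_derivative F') (at z)" and T: "(T has_derivative T') (at z)" and inj: "inj F'"
    and k: "principal_curvatures F T z k1 k2" "k1 \<noteq> k2"
    and l: "principal_curvatures F T z l1 l2"
  shows "(l1 = k1 \<and> l2 = k2) \<or> (l1 = k2 \<and> l2 = k1)"
proof -
  have fd: "frechet_derivative F (at z) = F'" "frechet_derivative T (at z) = T'"
    using frechet_derivative_at[OF F] frechet_derivative_at[OF T] by simp_all
  obtain v w where vw: "independent {v, w}" "v \<noteq> w"
    "T' v + k1 *\<^sub>R F' v = 0" "T' w + k2 *\<^sub>R F' w = 0"
    using k(1) by (auto simp: principal_curvatures_def fd)
  obtain x y where xy: "independent {x, y}" "x \<noteq> y"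
    "T' x + l1 *\<^sub>R F' x = 0" "T' y + l2 *\<^sub>R F' y = 0"
    using l by (auto simp: principal_curvatures_def fd)
  have nz: "x \<noteq> 0" "y \<noteq> 0" using xy(1) by (auto simp: dependent_zero)
  have not_both: "\<not> (x \<in> span {e} \<and> y \<in> span {e})" for e
  proof
    assume "x \<in> span {e} \<and> y \<in> span {e}"
    then obtain c d where cd: "x = c *\<^sub>R e" "y = d *\<^sub>R e" by (auto simp: span_singleton)
    then have "d *\<^sub>R x + (- c) *\<^sub>R y = 0" by simp
    from independent_pair_coefficients[OF xy(1,2) this] cd nz show False by simp
  qed
  show ?thesis
    using principal_curvatures_eigenvalue[OF F T inj vw k(2) xy(3) nz(1)]
      principal_curvatures_eigenvalue[OF F T inj vw k(2) xy(4) nz(2)] not_both by metis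
qed

lemma gauss_mean_curvature_eq:
  fixes F T :: "real^2 \<Rightarrow> real^6"
  assumes "(F has_derivative F') (at z)" "(T has_derivative T') (at z)" "inj F'"
    and k: "principal_curvatures F T z k1 k2" "k1 \<noteq> k2"
  shows "gauss_curvature F T z = k1 * k2" "mean_curvature F T z = (k1 + k2) / 2"
proof -
  note unique = distinct_principal_curvatures_unique[OF assms]
  show "gauss_curvature F T z = k1 * k2"
    unfolding gauss_curvature_def
  proof (rule the_equality)
    show "\<exists>l1 l2. principal_curvatures F T z l1 l2 \<and> k1 * k2 = l1 * l2" using k(1) by blast
  qed (use unique in fastforce)
  show "mean_curvature F T z = (k1 + k2) / 2"
    unfolding mean_curvature_def
  proof (rule the_equality)
    show "\<exists>l1 l2. principal_curvatures F T z l1 l2 \<and> (k1 + k2) / 2 = (l1 + l2) / 2" using k(1) by blast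
  qed (use unique in fastforce)
qed

text \<open>The Weingarten equation for the principal curvatures \<open>A / B\<close> and \<open>k2\<close> reads
  \<open>(a A + b B) k2 = - (b A + c B)\<close>, and the two linear forms in \<open>A, B\<close> have determinant
  \<open>a c - b\<^sup>2\<close>, so they cannot vanish together.\<close>

lemma weingarten_solve:
  fixes a b c A B k2 :: real
  assumes W: "a * (A / B * k2) + 2 * b * ((A / B + k2) / 2) + c = 0"
    and nt: "a * c - b\<^sup>2 \<noteq> 0" and B: "B \<noteq> 0"
  shows "(B * k2 - A) * (a * A + b * B) = - (a * A\<^sup>2 + 2 * b * A * B + c * B\<^sup>2)"
    and "a * A + b * B \<noteq> 0"
proof -
  have *: "(a * A + b * B) * k2 + (b * A + c * B) = B * (a * (A / B * k2) + 2 * b * ((A / B + k2) / 2)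
      + c)"
    using B by (simp add: field_simps)
  then have eq: "(a * A + b * B) * k2 = - (b * A + c * B)" using W by simp
  have "(B * k2 - A) * (a * A + b * B) = B * ((a * A + b * B) * k2) - A * (a * A + b * B)"
    by (simp add: algebra_simps)
  then show "(B * k2 - A) * (a * A + b * B) = - (a * A\<^sup>2 + 2 * b * A * B + c * B\<^sup>2)"
    unfolding eq by (simp add: algebra_simps power2_eq_square)
  show "a * A + b * B \<noteq> 0"
  proof
    assume 0: "a * A + b * B = 0"
    with eq have "b * A + c * B = 0" by simp
    moreover have "(a * c - b\<^sup>2) * B = a * (b * A + c * B) - b * (a * A + b * B)"
      by (simp add: algebra_simps power2_eq_square)
    ultimately show False using 0 nt B by simp
  qed
qed

section \<open>Curvature lines of a channel linear Weingarten surface\<close>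

text \<open>A piece of a channel linear Weingarten surface in one chart, on which the spheres are given by a
  curve \<open>\<sigma>\<close> and a parameter function \<open>u\<close>. The representatives \<open>\<sigma>\<close> are not normalized, which spares
  quotients of \<open>\<sigma>\<close>.\<close>

locale channel_patch =
  fixes p q :: "real^6" and U :: "(real^2) set" and F T :: "real^2 \<Rightarrow> real^6"
    and u :: "real^2 \<Rightarrow> real" and J :: "real set" and \<sigma> :: "real \<Rightarrow> real^6" and a b c :: real
  assumes open_U: "open U"
    and contact: "\<And>z. z \<in> U \<Longrightarrow> contact_element p q (F z) (T z)"
    and smooth_F: "smooth_on U F" and smooth_T: "smooth_on U T" and smooth_u: "smooth_on U u"
    and smooth_\<sigma>: "smooth_on J \<sigma>" and u_J: "u ` U \<subseteq> J"
    and tangency: "\<And>z v. z \<in> U \<Longrightarrow> lie_inner (frechet_derivative F (at z) v) (T z) = 0"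
    and inj_dF: "\<And>z. z \<in> U \<Longrightarrow> inj (frechet_derivative F (at z))"
    and no_umbilic: "\<And>z k. z \<in> U \<Longrightarrow> \<not> principal_curvatures F T z k k"
    and sphere_in_contact: "\<And>z. z \<in> U \<Longrightarrow> \<sigma> (u z) \<in> span {F z, T z}"
    and sphere_nonzero: "\<And>z. z \<in> U \<Longrightarrow> \<sigma> (u z) \<noteq> 0"
    and weingarten: "\<And>z. z \<in> U \<Longrightarrow> a * gauss_curvature F T z + 2 * b * mean_curvature F T z + c = 0"
    and non_tubular: "a * c - b\<^sup>2 \<noteq> 0"
begin

abbreviation "dF z \<equiv> frechet_derivative F (at z)"
abbreviation "dT z \<equiv> frechet_derivative T (at z)"
abbreviation "du z \<equiv> frechet_derivative u (at z)"
abbreviation "\<sigma>1 r \<equiv> frechet_derivative \<sigma> (at r) 1"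
abbreviation "\<sigma>2 r \<equiv> frechet_derivative \<sigma>1 (at r) 1"

text \<open>The coefficients of the sphere \<open>\<sigma> (u z)\<close> with respect to \<open>F z\<close> and \<open>T z\<close>, recovered from the
  products with \<open>q\<close> and \<open>p\<close>; in this form they are visibly functions of the parameter \<open>u z\<close>.\<close>

definition weight_f :: "real \<Rightarrow> real" where "weight_f r = - lie_inner (\<sigma> r) q"
definition weight_t :: "real \<Rightarrow> real" where "weight_t r = - lie_inner (\<sigma> r) p"

text \<open>The gradient of \<open>u\<close> turned by a right angle: a smooth field tangent to the level curves of \<open>u\<close>. It
  replaces a parametrization of these curves.\<close>

definition leaf_direction :: "real^2 \<Rightarrow> real^2" where
  "leaf_direction z = du z (axis 1 1) *\<^sub>R axis 2 1 - du z (axis 2 1) *\<^sub>R axis 1 1"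

definition leaf_tangent :: "real^2 \<Rightarrow> real^6" where "leaf_tangent z = dF z (leaf_direction z)"
definition leaf_acceleration :: "real^2 \<Rightarrow> real^6" where
    "leaf_acceleration z = frechet_derivative leaf_tangent (at z) (leaf_direction z)"

lemma F_derivative: "z \<in> U \<Longrightarrow> (F has_derivative dF z) (at z)"
  and T_derivative: "z \<in> U \<Longrightarrow> (T has_derivative dT z) (at z)"
  and u_derivative: "z \<in> U \<Longrightarrow> (u has_derivative du z) (at z)"
  using smooth_on_has_derivative smooth_F smooth_T smooth_u by blast+

lemma smooth_\<sigma>1: "smooth_on J \<sigma>1" and smooth_\<sigma>2: "smooth_on J \<sigma>2"
  using smooth_on_frechet_derivative smooth_\<sigma> by blast+

lemma \<sigma>_derivative: "r \<in> J \<Longrightarrow> (\<sigma> has_vector_derivative \<sigma>1 r) (at r)"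
  and \<sigma>1_derivative: "r \<in> J \<Longrightarrow> (\<sigma>1 has_vector_derivative \<sigma>2 r) (at r)"
  and \<sigma>2_derivative: "r \<in> J \<Longrightarrow> (\<sigma>2 has_vector_derivative frechet_derivative \<sigma>2 (at r) 1) (at r)"
  using smooth_on_has_vector_derivative smooth_\<sigma> smooth_\<sigma>1 smooth_\<sigma>2 by blast+

lemma linear_dF: "z \<in> U \<Longrightarrow> linear (dF z)" and linear_dT: "z \<in> U \<Longrightarrow> linear (dT z)"
  and linear_du: "z \<in> U \<Longrightarrow> linear (du z)"
  using F_derivative T_derivative u_derivative has_derivative_linear by blast+

lemma u_in_J: "z \<in> U \<Longrightarrow> u z \<in> J" using u_J by blast

text \<open>The derivative of \<open>(X, h(u)) = m(u)\<close>. Along the leaves, where \<open>du\<close> vanishes, \<open>h\<close> and \<open>m\<close> count as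
  constants.\<close>

lemma differentiate_pairing:
  assumes z: "z \<in> U" and X: "(X has_derivative X') (at z)"
    and h: "(h has_vector_derivative h') (at (u z))" and m: "(m has_real_derivative m') (at (u z))"
    and eq: "\<And>y. y \<in> U \<Longrightarrow> lie_inner (X y) (h (u y)) = m (u y)"
  shows "lie_inner (X' v) (h (u z)) + du z v * lie_inner (X z) h' = du z v * m'"
proof -
  have m': "((\<lambda>z. m (u z)) has_derivative (\<lambda>v. du z v *\<^sub>R m')) (at z)"
    by (rule has_derivative_curve_along[OF _ u_derivative[OF z]])
      (use m in \<open>simp add: has_real_derivative_iff_has_vector_derivative\<close>)
  from differentiate_lie_inner[OF open_U z X has_derivative_curve_along[OF h u_derivative[OF z]] m' eq, of v]
  show ?thesis by (simp add: lie_simps)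
qed

lemma dF_perp:
  assumes z: "z \<in> U"
  shows "lie_inner (dF z v) p = 0" "lie_inner (dF z v) q = 0" "lie_inner (dF z v) (F z) = 0"
    "lie_inner (dF z v) (T z) = 0"
proof -
  note c = contact_element.contact_simps[OF contact]
  show "lie_inner (dF z v) p = 0"
    using differentiate_lie_inner[OF open_U z F_derivative[OF z] has_derivative_const[of p] has_derivative_const[of 0], of v]
    by (simp add: c lie_simps)
  show "lie_inner (dF z v) q = 0"
    using differentiate_lie_inner[OF open_U z F_derivative[OF z] has_derivative_const[of q] has_derivative_const[of "-1"], of v]
    by (simp add: c lie_simps)
  show "lie_inner (dF z v) (F z) = 0"
    using differentiate_lie_inner[OF open_U z F_derivative[OF z] F_derivative[OF z] has_derivative_const[of 0], of v]
    by (simp add: c lie_inner_commute[of "F z"])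
  show "lie_inner (dF z v) (T z) = 0" by (rule tangency[OF z])
qed

lemma dT_perp:
  assumes z: "z \<in> U"
  shows "lie_inner (dT z v) p = 0" "lie_inner (dT z v) q = 0" "lie_inner (dT z v) (F z) = 0"
    "lie_inner (dT z v) (T z) = 0"
proof -
  note c = contact_element.contact_simps[OF contact]
  show "lie_inner (dT z v) p = 0"
    using differentiate_lie_inner[OF open_U z T_derivative[OF z] has_derivative_const[of p] has_derivative_const[of "-1"], of v]
    by (simp add: c lie_simps)
  show "lie_inner (dT z v) q = 0"
    using differentiate_lie_inner[OF open_U z T_derivative[OF z] has_derivative_const[of q] has_derivative_const[of 0], of v]
    by (simp add: c lie_simps)
  show "lie_inner (dT z v) (T z) = 0"
    using differentiate_lie_inner[OF open_U z T_derivative[OF z] T_derivative[OF z] has_derivative_const[of 0], of v]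
    by (simp add: c lie_inner_commute[of "T z"])
  show "lie_inner (dT z v) (F z) = 0"
    using differentiate_lie_inner[OF open_U z T_derivative[OF z] F_derivative[OF z] has_derivative_const[of 0], of v]
    by (simp add: c lie_inner_commute[of "T z"] dF_perp[OF z])
qed

lemma dF_positive:
  assumes "z \<in> U" "v \<noteq> 0"
  shows "lie_inner (dF z v) (dF z v) > 0"
proof -
  interpret contact_element p q "F z" "T z" by (rule contact[OF assms(1)])
  have "dF z v \<noteq> 0"
    using inj_dF[OF assms(1)] assms(2) linear_injective_0[OF linear_dF[OF assms(1)]] by blast
  then show ?thesis
    by (intro lie_positive_definite_on_tangent[OF pp qp ff fp fq]) (simp_all add: dF_perp assms)
qed

lemma sphere_decomposition:
  assumes "z \<in> U"
  shows "\<sigma> (u z) = weight_f (u z) *\<^sub>R F z + weight_t (u z) *\<^sub>R T z"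
proof -
  interpret contact_element p q "F z" "T z" by (rule contact[OF assms])
  obtain x y where xy: "\<sigma> (u z) = x *\<^sub>R F z + y *\<^sub>R T z"
    using in_span_pair[OF sphere_in_contact[OF assms]] by blast
  then have "weight_f (u z) = x" "weight_t (u z) = y"
      by (simp_all add: weight_f_def weight_t_def lie_simps contact_simps)
  with xy show ?thesis by simp
qed

lemma sphere_perp:
  assumes "z \<in> U"
  shows "lie_inner (F z) (\<sigma> (u z)) = 0" "lie_inner (T z) (\<sigma> (u z)) = 0"
    "lie_inner (\<sigma> (u z)) (\<sigma> (u z)) = 0" "lie_inner (dF z v) (\<sigma> (u z)) = 0"
proof -
  interpret contact_element p q "F z" "T z" by (rule contact[OF assms])
  show "lie_inner (F z) (\<sigma> (u z)) = 0" "lie_inner (T z) (\<sigma> (u z)) = 0"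
    "lie_inner (\<sigma> (u z)) (\<sigma> (u z)) = 0" "lie_inner (dF z v) (\<sigma> (u z)) = 0"
    using dF_perp[OF assms] by (simp_all add: sphere_decomposition[OF assms] lie_simps contact_simps)
qed

lemma sphere_derivative:
  assumes z: "z \<in> U"
  shows "du z v *\<^sub>R \<sigma>1 (u z) = weight_f (u z) *\<^sub>R dF z v + weight_t (u z) *\<^sub>R dT z v
    - (du z v * lie_inner (\<sigma>1 (u z)) q) *\<^sub>R F z - (du z v * lie_inner (\<sigma>1 (u z)) p) *\<^sub>R T z"
proof -
  note s = has_derivative_curve_along[OF \<sigma>_derivative[OF u_in_J[OF z]] u_derivative[OF z]]
  have d: "((\<lambda>z. weight_f (u z)) has_derivative (\<lambda>v. - (du z v * lie_inner (\<sigma>1 (u z)) q))) (at z)"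
    "((\<lambda>z. weight_t (u z)) has_derivative (\<lambda>v. - (du z v * lie_inner (\<sigma>1 (u z)) p))) (at z)"
    unfolding weight_f_def weight_t_def
    by (auto intro!: derivative_eq_intros lie.FDERIV[OF s has_derivative_const] simp: lie_simps)
  have "((\<lambda>y. weight_f (u y) *\<^sub>R F y + weight_t (u y) *\<^sub>R T y) has_derivative
      (\<lambda>v. (weight_f (u z) *\<^sub>R dF z v + (- (du z v * lie_inner (\<sigma>1 (u z)) q)) *\<^sub>R F z) +
           (weight_t (u z) *\<^sub>R dT z v + (- (du z v * lie_inner (\<sigma>1 (u z)) p)) *\<^sub>R T z))) (at z)"
    by (intro has_derivative_add has_derivative_scaleR d F_derivative T_derivative z)
  then have "((\<lambda>y. \<sigma> (u y)) has_derivative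
      (\<lambda>v. (weight_f (u z) *\<^sub>R dF z v + (- (du z v * lie_inner (\<sigma>1 (u z)) q)) *\<^sub>R F z) +
           (weight_t (u z) *\<^sub>R dT z v + (- (du z v * lie_inner (\<sigma>1 (u z)) p)) *\<^sub>R T z))) (at z)"
    by (rule has_derivative_transform_within_open[OF _ open_U z]) (simp add: sphere_decomposition)
  from fun_cong[OF has_derivative_unique[OF s this], of v] show ?thesis by simp
qed

lemma du_leaf_direction: "z \<in> U \<Longrightarrow> du z (leaf_direction z) = 0"
  by (simp add: leaf_direction_def linear_diff[OF linear_du] linear_scale[OF linear_du])

lemma leaf_direction_eq_0D:
  assumes "leaf_direction z = 0"
  shows "du z (axis 1 1) = 0" "du z (axis 2 1) = 0"
proof -
  from assms show "du z (axis 1 1) = 0" "du z (axis 2 1) = 0"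
    using rotated_eq_0 by (auto simp: leaf_direction_def)
qed

text \<open>A sphere of the family cannot be the point \<open>F z\<close> itself: otherwise the leaf direction would be a
  nonzero vector in the kernel of \<open>dF\<close>.\<close>

lemma weight_t_nonzero:
  assumes z: "z \<in> U"
  shows "weight_t (u z) \<noteq> 0"
proof
  assume B0: "weight_t (u z) = 0"
  then have A0: "weight_f (u z) \<noteq> 0" using sphere_decomposition[OF z] sphere_nonzero[OF z] by auto
  have zero: "w = 0" if "du z w = 0" for w
  proof -
    have "weight_f (u z) *\<^sub>R dF z w = 0" using sphere_derivative[OF z, of w] that B0 by simp
    with A0 have "dF z w = 0" by simp
    then show "w = 0" using inj_dF[OF z] linear_injective_0[OF linear_dF[OF z]] by blast
  qed
  have "leaf_direction z = 0" using zero du_leaf_direction[OF z] by blast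
  from zero[OF leaf_direction_eq_0D(1)[OF this]] show False by (simp add: axis_eq_0_iff)
qed

text \<open>At a critical point of \<open>u\<close> every direction would be principal with the same curvature, and the
  point would be umbilic. So the leaves form a foliation.\<close>

lemma du_nonzero:
  assumes z: "z \<in> U"
  shows "\<exists>v. du z v \<noteq> 0"
proof (rule ccontr)
  assume "\<not> (\<exists>v. du z v \<noteq> 0)"
  then have "weight_f (u z) *\<^sub>R dF z v + weight_t (u z) *\<^sub>R dT z v = 0" for v
    using sphere_derivative[OF z, of v] by simp
  then have "(1 / weight_t (u z)) *\<^sub>R (weight_f (u z) *\<^sub>R dF z v + weight_t (u z) *\<^sub>R dT z v)
      = 0" for v by simp
  then have "dT z v + (weight_f (u z) / weight_t (u z)) *\<^sub>R dF z v = 0" for v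
    using weight_t_nonzero[OF z] by (simp add: scaleR_add_right add.commute)
  then have "principal_curvatures F T z (weight_f (u z) / weight_t (u z)) (weight_f (u z) / weight_t (u z))"
    unfolding principal_curvatures_def using independent_axes by blast
  with no_umbilic[OF z] show False by blast
qed

lemma leaf_direction_nonzero:
  assumes z: "z \<in> U"
  shows "leaf_direction z \<noteq> 0"
proof
  assume "leaf_direction z = 0"
  note * = leaf_direction_eq_0D[OF this]
  obtain v where "du z v \<noteq> 0" using du_nonzero[OF z] by blast
  moreover obtain x y where "v = x *\<^sub>R axis 1 1 + y *\<^sub>R axis 2 1"
    using plane_eq_span_pair[OF independent_axes] by blast
  ultimately show False using *
      by (simp add: linear_add[OF linear_du[OF z]] linear_scale[OF linear_du[OF z]])
qed

lemma leaf_direction_principal: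
  assumes z: "z \<in> U"
  shows "dT z (leaf_direction z) + (weight_f (u z) / weight_t (u z)) *\<^sub>R dF z (leaf_direction z) = 0"
proof -
  have "(1 / weight_t (u z)) *\<^sub>R (weight_f (u z) *\<^sub>R dF z (leaf_direction z)
      + weight_t (u z) *\<^sub>R dT z (leaf_direction z)) = 0"
    using sphere_derivative[OF z, of "leaf_direction z"] by (simp add: du_leaf_direction[OF z])
  then show ?thesis using weight_t_nonzero[OF z] by (simp add: scaleR_add_right add.commute)
qed

lemma sphere1_perp_F:
  assumes z: "z \<in> U"
  shows "lie_inner (F z) (\<sigma>1 (u z)) = 0" "lie_inner (\<sigma> (u z)) (\<sigma>1 (u z)) = 0"
proof -
  obtain v where v: "du z v \<noteq> 0" using du_nonzero[OF z] by blast
  have "lie_inner (dF z v) (\<sigma> (u z)) + du z v * lie_inner (F z) (\<sigma>1 (u z)) = du z v * 0"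
    by (rule differentiate_pairing[OF z F_derivative[OF z] \<sigma>_derivative[OF u_in_J[OF z]] DERIV_const])
      (simp add: sphere_perp)
  with v show "lie_inner (F z) (\<sigma>1 (u z)) = 0" by (simp add: sphere_perp[OF z])
  note s = has_derivative_curve_along[OF \<sigma>_derivative[OF u_in_J[OF z]] u_derivative[OF z]]
  have "lie_inner (du z v *\<^sub>R \<sigma>1 (u z)) (\<sigma> (u z)) + lie_inner (\<sigma> (u z)) (du z v *\<^sub>R \<sigma>1 (u z)) = 0"
    by (rule differentiate_lie_inner[OF open_U z s s has_derivative_const]) (simp add: sphere_perp)
  with v show "lie_inner (\<sigma> (u z)) (\<sigma>1 (u z)) = 0"
    by (simp add: lie_simps lie_inner_commute[of "\<sigma>1 (u z)"])
qed

text \<open>Since \<open>u\<close> has no critical points, a relation \<open>h(u) = 0\<close> on the surface may be differentiated with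
  respect to \<open>u\<close>. In particular \<open>\<sigma>'\<close> is orthogonal to the leaves, which expresses the symmetry of
  the shape operator without second derivatives of \<open>F\<close>.\<close>

lemma dF_sphere1:
  assumes z: "z \<in> U"
  shows "lie_inner (dF z v) (\<sigma>1 (u z)) + du z v * lie_inner (F z) (\<sigma>2 (u z)) = 0"
    and "lie_inner (\<sigma>1 (u z)) (\<sigma>1 (u z)) + lie_inner (\<sigma> (u z)) (\<sigma>2 (u z)) = 0"
proof -
  have "lie_inner (dF z v) (\<sigma>1 (u z)) + du z v * lie_inner (F z) (\<sigma>2 (u z)) = du z v * 0"
    by (rule differentiate_pairing[OF z F_derivative[OF z] \<sigma>1_derivative[OF u_in_J[OF z]] DERIV_const])
      (simp add: sphere1_perp_F)
  then show "lie_inner (dF z v) (\<sigma>1 (u z)) + du z v * lie_inner (F z) (\<sigma>2 (u z)) = 0" by simp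
  obtain w where w: "du z w \<noteq> 0" using du_nonzero[OF z] by blast
  note s = has_derivative_curve_along[OF \<sigma>_derivative[OF u_in_J[OF z]] u_derivative[OF z]]
  have "lie_inner (du z w *\<^sub>R \<sigma>1 (u z)) (\<sigma>1 (u z)) + du z w * lie_inner (\<sigma> (u z)) (\<sigma>2 (u z))
      = du z w * 0"
    by (rule differentiate_pairing[OF z s \<sigma>1_derivative[OF u_in_J[OF z]] DERIV_const])
      (simp add: sphere1_perp_F)
  then have "du z w * (lie_inner (\<sigma>1 (u z)) (\<sigma>1 (u z)) + lie_inner (\<sigma> (u z)) (\<sigma>2 (u z))) = 0"
    by (simp add: lie_simps algebra_simps)
  with w show "lie_inner (\<sigma>1 (u z)) (\<sigma>1 (u z)) + lie_inner (\<sigma> (u z)) (\<sigma>2 (u z)) = 0" by simp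
qed

text \<open>The direction orthogonal to the leaf in the first fundamental form. By the derivative of
  \<open>\<sigma> = \<alpha> F + \<beta> T\<close> and \<open>\<sigma>'\<close> being orthogonal to the leaf, \<open>dT x\<close> is orthogonal to the leaf too,
  hence proportional to \<open>dF x\<close>.\<close>

lemma second_principal_direction:
  assumes z: "z \<in> U"
  obtains x k2 where "x \<noteq> 0" "lie_inner (dF z x) (leaf_tangent z) = 0" "dT z x + k2 *\<^sub>R dF z x = 0"
    "independent {leaf_direction z, x}" "leaf_direction z \<noteq> x"
proof -
  interpret contact_element p q "F z" "T z" by (rule contact[OF z])
  note lF = linear_dF[OF z] and lT = linear_dT[OF z]
  define x where
      "x = lie_inner (dF z (axis 1 1)) (leaf_tangent z) *\<^sub>R axis 2 1
          - lie_inner (dF z (axis 2 1)) (leaf_tangent z) *\<^sub>R (axis 1 1 :: real^2)"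
  have GG: "lie_inner (leaf_tangent z) (leaf_tangent z) > 0"
    unfolding leaf_tangent_def by (rule dF_positive[OF z leaf_direction_nonzero[OF z]])
  have xG: "lie_inner (dF z x) (leaf_tangent z) = 0"
    by (simp add: x_def linear_diff[OF lF] linear_scale[OF lF] lie_simps)
  have x0: "x \<noteq> 0"
  proof
    assume "x = 0"
    then have *: "lie_inner (dF z (axis 2 1)) (leaf_tangent z) = 0"
        "lie_inner (dF z (axis 1 1)) (leaf_tangent z) = 0"
      using rotated_eq_0 by (auto simp: x_def)
    have "leaf_tangent z = du z (axis 1 1) *\<^sub>R dF z (axis 2 1) - du z (axis 2 1) *\<^sub>R dF z (axis 1 1)"
      by (simp add: leaf_tangent_def leaf_direction_def linear_diff[OF lF] linear_scale[OF lF])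
    then have "lie_inner (leaf_tangent z) (leaf_tangent z)
        = du z (axis 1 1) * lie_inner (dF z (axis 2 1)) (leaf_tangent z)
        - du z (axis 2 1) * lie_inner (dF z (axis 1 1)) (leaf_tangent z)"
      by (metis lie.diff_left lie.scaleR_left real_scaleR_def)
    then have "lie_inner (leaf_tangent z) (leaf_tangent z) = 0" using * by simp
    with GG show False by simp
  qed
  have notin: "leaf_direction z \<notin> span {x}"
  proof
    assume "leaf_direction z \<in> span {x}"
    then obtain e where "leaf_direction z = e *\<^sub>R x" by (auto simp: span_singleton)
    then have "lie_inner (leaf_tangent z) (leaf_tangent z) = e * lie_inner (dF z x) (leaf_tangent z)"
      by (metis leaf_tangent_def lie.scaleR_left linear_scale[OF lF] real_scaleR_def)
    with xG GG show False by simp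
  qed
  have ind: "independent {leaf_direction z, x}" "leaf_direction z \<noteq> x"
    using notin x0 by (auto simp: independent_insert span_base)
  have "lie_inner (dF z (leaf_direction z)) (\<sigma>1 (u z)) = 0"
    using dF_sphere1(1)[OF z, of "leaf_direction z"] by (simp add: du_leaf_direction[OF z])
  then have "lie_inner (\<sigma>1 (u z)) (leaf_tangent z) = 0"
      by (simp add: leaf_tangent_def lie_inner_commute)
  moreover have FG: "lie_inner (F z) (leaf_tangent z) = 0" "lie_inner (T z) (leaf_tangent z) = 0"
    using dF_perp[OF z, of "leaf_direction z"] by (simp_all add: leaf_tangent_def lie_inner_commute)
  ultimately have "weight_t (u z) * lie_inner (dT z x) (leaf_tangent z) = 0"
    using arg_cong[OF sphere_derivative[OF z, of x], of "\<lambda>y. lie_inner y (leaf_tangent z)"] xG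
    by (simp add: lie_simps)
  then have TG: "lie_inner (dT z x) (leaf_tangent z) = 0" using weight_t_nonzero[OF z] by simp
  obtain y where y: "dT z x = dF z y"
    using tangent_vectors_are_derivatives[OF lF inj_dF[OF z] dF_perp[OF z] dT_perp[OF z]] by blast
  obtain e d where ed: "y = e *\<^sub>R leaf_direction z + d *\<^sub>R x" using plane_eq_span_pair[OF ind] by blast
  have "lie_inner (dT z x) (leaf_tangent z) = e * lie_inner (leaf_tangent z) (leaf_tangent z)
      + d * lie_inner (dF z x) (leaf_tangent z)"
    by (simp add: y ed linear_add[OF lF] linear_scale[OF lF] lie_simps leaf_tangent_def)
  with TG xG GG have "e = 0" by simp
  then have "dT z x + (- d) *\<^sub>R dF z x = 0" by (simp add: y ed linear_scale[OF lF])
  from that[OF x0 xG this ind] show ?thesis .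
qed

text \<open>\<open>weingarten_form\<close> is, up to a nonzero factor, the difference of the principal curvatures, and
  \<open>leaf_height\<close> is the common value of \<open>(F, \<sigma>'')\<close> along a leaf; both are functions of \<open>u\<close> by virtue
  of the Weingarten equation.\<close>

definition squared_speed :: "real \<Rightarrow> real" where "squared_speed r = lie_inner (\<sigma>1 r) (\<sigma>1 r)"
definition weingarten_form :: "real \<Rightarrow> real" where
    "weingarten_form r = a * (weight_f r)\<^sup>2 + 2 * b * weight_f r * weight_t r + c * (weight_t r)\<^sup>2"
definition leaf_height :: "real \<Rightarrow> real" where
    "leaf_height r = - (squared_speed r * (a * weight_f r + b * weight_t r)) / weingarten_form r"

text \<open>The key step. With \<open>x\<close> the second principal direction and \<open>l\<close> its curvature, the derivative of
  \<open>\<sigma>(u) = \<alpha> F + \<beta> T\<close> in direction \<open>x\<close> gives \<open>du(x) \<sigma>' = (\<alpha> - \<beta> l) dF(x)\<close> up to multiples of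
  \<open>F\<close> and \<open>T\<close>. Its square compares \<open>(\<sigma>', \<sigma>')\<close> with \<open>|dF(x)|\<^sup>2\<close>, its product with \<open>dF(x)\<close> compares
  \<open>(dF(x), \<sigma>') = - du(x) (F, \<sigma>'')\<close> with \<open>|dF(x)|\<^sup>2\<close>, so \<open>(F, \<sigma>'') = (\<sigma>', \<sigma>') / (\<beta> l - \<alpha>)\<close>. The
  Weingarten equation turns \<open>\<beta> l - \<alpha>\<close> into a function of \<open>\<alpha>\<close> and \<open>\<beta>\<close>.\<close>

lemma curvature_relation:
  assumes z: "z \<in> U"
  shows "squared_speed (u z) > 0" "weingarten_form (u z) \<noteq> 0"
      "lie_inner (F z) (\<sigma>2 (u z)) = leaf_height (u z)"
proof -
  interpret contact_element p q "F z" "T z" by (rule contact[OF z])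
  note lF = linear_dF[OF z] and lT = linear_dT[OF z]
  obtain x k2 where x: "x \<noteq> 0" "lie_inner (dF z x) (leaf_tangent z) = 0" "dT z x + k2 *\<^sub>R dF z x = 0"
    "independent {leaf_direction z, x}" "leaf_direction z \<noteq> x"
    by (rule second_principal_direction[OF z])
  define k where "k = weight_f (u z) / weight_t (u z)"
  have Bk: "weight_t (u z) * k = weight_f (u z)" using weight_t_nonzero[OF z] by (simp add: k_def)
  have pc: "principal_curvatures F T z k k2"
    unfolding principal_curvatures_def k_def using leaf_direction_principal[OF z] x by blast
  with no_umbilic[OF z] have kk: "k \<noteq> k2" by blast
  have "a * (weight_f (u z) / weight_t (u z) * k2) + 2 * b * ((weight_f (u z) / weight_t (u z)
      + k2) / 2) + c = 0"
    using weingarten[OF z] gauss_mean_curvature_eq[OF F_derivative[OF z] T_derivative[OF z] inj_dF[OF z] pc kk]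
    by (simp add: k_def)
  note solved = weingarten_solve[OF this non_tubular weight_t_nonzero[OF z]]
  define d where "d = weight_t (u z) * k2 - weight_f (u z)"
  have d: "d \<noteq> 0" using kk Bk weight_t_nonzero[OF z] by (simp add: d_def flip: Bk right_diff_distrib)
  have dQ: "d * (a * weight_f (u z) + b * weight_t (u z)) = - weingarten_form (u z)" using solved(1)
      by (simp add: d_def weingarten_form_def)
  with d solved(2) show Q_nz: "weingarten_form (u z) \<noteq> 0" by auto
  have dux: "du z x \<noteq> 0"
  proof
    assume "du z x = 0"
    moreover obtain v where "du z v \<noteq> 0" using du_nonzero[OF z] by blast
    moreover obtain s t where "v = s *\<^sub>R leaf_direction z + t *\<^sub>R x"
        using plane_eq_span_pair[OF x(4,5)] by blast
    ultimately show False
      using du_leaf_direction[OF z]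
          by (simp add: linear_add[OF linear_du[OF z]] linear_scale[OF linear_du[OF z]])
  qed
  define e g where "e = du z x * lie_inner (\<sigma>1 (u z)) q" and "g = du z x * lie_inner (\<sigma>1 (u z)) p"
  have dTx: "dT z x = - k2 *\<^sub>R dF z x" using x(3) by (simp add: eq_neg_iff_add_eq_0)
  have s1: "du z x *\<^sub>R \<sigma>1 (u z) = (- d) *\<^sub>R dF z x - e *\<^sub>R F z - g *\<^sub>R T z"
    using sphere_derivative[OF z, of x] by (simp add: dTx d_def e_def g_def algebra_simps)
  define N where "N = lie_inner (dF z x) (dF z x)"
  have N: "N > 0" unfolding N_def by (rule dF_positive[OF z x(1)])
  note perp = dF_perp[OF z] dF_perp[OF z, unfolded lie_inner_commute[of "dF z _"]]
  have "(du z x)\<^sup>2 * squared_speed (u z) = lie_inner (du z x *\<^sub>R \<sigma>1 (u z)) (du z x *\<^sub>R \<sigma>1 (u z))"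
    by (simp add: squared_speed_def lie_simps power2_eq_square)
  also have "\<dots> = d\<^sup>2 * N"
    unfolding s1 by (simp add: lie_simps perp contact_simps N_def power2_eq_square)
  finally have nd: "(du z x)\<^sup>2 * squared_speed (u z) = d\<^sup>2 * N" .
  then have "(du z x)\<^sup>2 * squared_speed (u z) > 0" using N d by simp
  then show "squared_speed (u z) > 0" by (simp add: zero_less_mult_iff)
  have "du z x * lie_inner (dF z x) (\<sigma>1 (u z)) = - d * N"
    using arg_cong[OF s1, of "lie_inner (dF z x)"] by (simp add: lie_simps perp N_def)
  moreover have "lie_inner (dF z x) (\<sigma>1 (u z)) = - (du z x * lie_inner (F z) (\<sigma>2 (u z)))"
    using dF_sphere1(1)[OF z, of x] by simp
  ultimately have "(du z x)\<^sup>2 * lie_inner (F z) (\<sigma>2 (u z)) = d * N" by (simp add: power2_eq_square)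
  then have "(du z x)\<^sup>2 * squared_speed (u z) = (du z x)\<^sup>2 * (d * lie_inner (F z) (\<sigma>2 (u z)))"
    using nd by (simp add: power2_eq_square)
  then have "squared_speed (u z) = d * lie_inner (F z) (\<sigma>2 (u z))" using dux by simp
  then have "squared_speed (u z) * (a * weight_f (u z) + b * weight_t (u z)) =
      - weingarten_form (u z) * lie_inner (F z) (\<sigma>2 (u z))"
    by (simp flip: dQ)
  then show "lie_inner (F z) (\<sigma>2 (u z)) = leaf_height (u z)" using Q_nz
      by (simp add: leaf_height_def field_simps)
qed

section \<open>The spheres are orthogonal to a fixed plane\<close>

lemma leaf_tangent_derivative:
  assumes z: "z \<in> U"
  shows "(leaf_tangent has_derivative frechet_derivative leaf_tangent (at z)) (at z)"
proof -
  let ?H = "\<lambda>y. du y (axis 1 1) *\<^sub>R dF y (axis 2 1) - du y (axis 2 1) *\<^sub>R dF y (axis 1 1)"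
  have "?H differentiable (at z)"
    using smooth_on_has_derivative[OF smooth_on_frechet_derivative[OF smooth_F] z]
      smooth_on_has_derivative[OF smooth_on_frechet_derivative[OF smooth_u] z]
    by (intro differentiable_diff differentiable_scaleR) (auto simp: differentiable_def)
  then obtain H' where H': "(?H has_derivative H') (at z)" by (auto simp: differentiable_def)
  have "(leaf_tangent has_derivative H') (at z)"
    by (rule has_derivative_transform_within_open[OF H' open_U z])
      (simp add: leaf_tangent_def leaf_direction_def linear_diff[OF linear_dF] linear_scale[OF linear_dF])
  then show ?thesis using frechet_derivative_at by metis
qed

lemma weight_f_derivative: "r \<in> J \<Longrightarrow> (weight_f has_real_derivative - lie_inner (\<sigma>1 r) q) (at r)"
  and weight_t_derivative: "r \<in> J \<Longrightarrow> (weight_t has_real_derivative - lie_inner (\<sigma>1 r) p) (at r)"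
  unfolding weight_f_def weight_t_def has_real_derivative_iff_has_vector_derivative
  by (auto intro!: derivative_eq_intros lie.has_vector_derivative \<sigma>_derivative
      simp: lie_simps)

lemma squared_speed_derivative: "r \<in> J \<Longrightarrow> (squared_speed has_real_derivative 2 * lie_inner (\<sigma>2 r) (\<sigma>1 r)) (at r)"
  using lie.has_vector_derivative[OF \<sigma>1_derivative \<sigma>1_derivative, of r]
  unfolding squared_speed_def has_real_derivative_iff_has_vector_derivative
  by (simp add: lie_inner_commute[of "\<sigma>1 r" "\<sigma>2 r"])

lemma leaf_height_derivative:
  assumes z: "z \<in> U"
  shows "\<exists>m. (leaf_height has_real_derivative m) (at (u z))"
proof -
  have "weight_f differentiable (at (u z))" "weight_t differentiable (at (u z))"
      "squared_speed differentiable (at (u z))"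
    using weight_f_derivative weight_t_derivative squared_speed_derivative u_in_J[OF z]
        by (auto simp: real_differentiable_def)
  then have "leaf_height differentiable (at (u z))"
    unfolding leaf_height_def weingarten_form_def
        using curvature_relation(2)[OF z, unfolded weingarten_form_def]
    by (intro differentiable_divide differentiable_minus differentiable_mult differentiable_add
        differentiable_power differentiable_const) auto
  then show ?thesis by (simp add: real_differentiable_def)
qed

text \<open>The derivatives along the leaf of the products of \<open>F\<close> with \<open>p, q, F, \<sigma>, \<sigma>', \<sigma>''\<close>, all of which
  are constant on leaves. The same step applied to the leaf tangent in place of \<open>F\<close> gives
  \<open>leaf_acceleration_perp\<close>.\<close>

lemma leaf_tangent_perp:
  assumes z: "z \<in> U"
  shows "lie_inner (leaf_tangent z) p = 0" "lie_inner (leaf_tangent z) q = 0"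
      "lie_inner (leaf_tangent z) (F z) = 0"
    "lie_inner (leaf_tangent z) (\<sigma> (u z)) = 0" "lie_inner (leaf_tangent z) (\<sigma>1 (u z)) = 0"
        "lie_inner (leaf_tangent z) (\<sigma>2 (u z)) = 0"
proof -
  show "lie_inner (leaf_tangent z) p = 0" "lie_inner (leaf_tangent z) q = 0"
      "lie_inner (leaf_tangent z) (F z) = 0"
    "lie_inner (leaf_tangent z) (\<sigma> (u z)) = 0"
    by (simp_all add: leaf_tangent_def dF_perp[OF z] sphere_perp[OF z])
  show "lie_inner (leaf_tangent z) (\<sigma>1 (u z)) = 0"
    using dF_sphere1(1)[OF z, of "leaf_direction z"]
        by (simp add: leaf_tangent_def du_leaf_direction[OF z])
  obtain m where m: "(leaf_height has_real_derivative m) (at (u z))"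
      using leaf_height_derivative[OF z] by blast
  from differentiate_pairing[OF z F_derivative[OF z] \<sigma>2_derivative[OF u_in_J[OF z]] m curvature_relation(3), of "leaf_direction z"]
  show "lie_inner (leaf_tangent z) (\<sigma>2 (u z)) = 0"
      by (simp add: leaf_tangent_def du_leaf_direction[OF z])
qed

lemma leaf_tangent_positive: "z \<in> U \<Longrightarrow> lie_inner (leaf_tangent z) (leaf_tangent z) > 0"
  unfolding leaf_tangent_def by (intro dF_positive leaf_direction_nonzero)

lemma leaf_acceleration_perp:
  assumes z: "z \<in> U"
  shows "lie_inner (leaf_acceleration z) p = 0" "lie_inner (leaf_acceleration z) q = 0"
      "lie_inner (leaf_acceleration z) (F z) = - lie_inner (leaf_tangent z) (leaf_tangent z)"
    "lie_inner (leaf_acceleration z) (\<sigma> (u z)) = 0" "lie_inner (leaf_acceleration z) (\<sigma>1 (u z)) = 0"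
        "lie_inner (leaf_acceleration z) (\<sigma>2 (u z)) = 0"
proof -
  note d = differentiate_pairing[OF z leaf_tangent_derivative[OF z] _ DERIV_const, of _ _ 0 "leaf_direction z"]
  show "lie_inner (leaf_acceleration z) p = 0" using d[of "\<lambda>_. p" 0]
      by (simp add: leaf_tangent_perp leaf_acceleration_def du_leaf_direction[OF z])
  show "lie_inner (leaf_acceleration z) q = 0" using d[of "\<lambda>_. q" 0]
      by (simp add: leaf_tangent_perp leaf_acceleration_def du_leaf_direction[OF z])
  show "lie_inner (leaf_acceleration z) (\<sigma> (u z)) = 0"
    using d[OF \<sigma>_derivative[OF u_in_J[OF z]]]
        by (simp add: leaf_tangent_perp leaf_acceleration_def du_leaf_direction[OF z])
  show "lie_inner (leaf_acceleration z) (\<sigma>1 (u z)) = 0"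
    using d[OF \<sigma>1_derivative[OF u_in_J[OF z]]]
        by (simp add: leaf_tangent_perp leaf_acceleration_def du_leaf_direction[OF z])
  show "lie_inner (leaf_acceleration z) (\<sigma>2 (u z)) = 0"
    using d[OF \<sigma>2_derivative[OF u_in_J[OF z]]]
        by (simp add: leaf_tangent_perp leaf_acceleration_def du_leaf_direction[OF z])
  show "lie_inner (leaf_acceleration z) (F z) = - lie_inner (leaf_tangent z) (leaf_tangent z)"
    using differentiate_lie_inner[OF open_U z leaf_tangent_derivative[OF z] F_derivative[OF z] has_derivative_const[of 0], of "leaf_direction z"]
    by (simp add: leaf_tangent_perp leaf_acceleration_def eq_neg_iff_add_eq_0 flip: leaf_tangent_def)
qed

text \<open>The coefficients of \<open>\<sigma>''\<close> in \<open>p, q, \<sigma>, \<sigma>'\<close>, read off from the products with \<open>F\<close>, \<open>\<sigma>\<close>, \<open>\<sigma>'\<close> and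
  \<open>p\<close> in this order. The explicit formulas show that they are continuous functions of \<open>u\<close>.\<close>

definition "coeff_q r = - leaf_height r"
definition "coeff_p r = (squared_speed r - weight_f r * coeff_q r) / weight_t r"
definition "coeff_\<sigma>1 r =
  (lie_inner (\<sigma>2 r) (\<sigma>1 r) - coeff_p r * lie_inner (\<sigma>1 r) p
      - coeff_q r * lie_inner (\<sigma>1 r) q) / squared_speed r"
definition "coeff_\<sigma> r = - (lie_inner (\<sigma>2 r) p + coeff_p r
    - coeff_\<sigma>1 r * lie_inner (\<sigma>1 r) p) / weight_t r"

text \<open>The difference \<open>R\<close> of the two sides is orthogonal to \<open>F, p, \<sigma>, \<sigma>'\<close> by the choice of the
  coefficients, and to the velocity and acceleration of the leaf because all terms are. These six
  vectors form a basis.\<close>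

lemma sphere2_eq:
  assumes z: "z \<in> U" and r: "r = u z"
  shows "\<sigma>2 r = coeff_p r *\<^sub>R p + coeff_q r *\<^sub>R q + coeff_\<sigma> r *\<^sub>R \<sigma> r + coeff_\<sigma>1 r *\<^sub>R \<sigma>1 r"
proof -
  interpret contact_element p q "F z" "T z" by (rule contact[OF z])
  define R where
      "R = \<sigma>2 r - (coeff_p r *\<^sub>R p + coeff_q r *\<^sub>R q + coeff_\<sigma> r *\<^sub>R \<sigma> r + coeff_\<sigma>1 r *\<^sub>R \<sigma>1 r)"
  have Bnz: "weight_t r \<noteq> 0" and nnz: "squared_speed r \<noteq> 0"
    using weight_t_nonzero[OF z] curvature_relation(1)[OF z] by (auto simp: r)
  have \<sigma>: "lie_inner (\<sigma> r) p = - weight_t r" "lie_inner p (\<sigma> r) = - weight_t r"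
      "lie_inner (\<sigma> r) q = - weight_f r" "lie_inner q (\<sigma> r) = - weight_f r"
    by (simp_all add: weight_f_def weight_t_def lie_inner_commute)
  have \<sigma>1: "lie_inner (\<sigma>1 r) (\<sigma>1 r) = squared_speed r" "lie_inner (\<sigma> r) (\<sigma>1 r) = 0"
      "lie_inner (\<sigma>1 r) (\<sigma> r) = 0"
    "lie_inner p (\<sigma>1 r) = lie_inner (\<sigma>1 r) p" "lie_inner q (\<sigma>1 r) = lie_inner (\<sigma>1 r) q"
    using sphere1_perp_F(2)[OF z] by (simp_all add: squared_speed_def r lie_inner_commute)
  have \<sigma>2: "lie_inner (\<sigma>2 r) (\<sigma> r) = - squared_speed r"
    using dF_sphere1(2)[OF z] by (simp add: squared_speed_def r lie_inner_commute[of "\<sigma>2 _" "\<sigma> _"])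
  have \<sigma>F: "lie_inner (\<sigma> r) (F z) = 0" "lie_inner (\<sigma>1 r) (F z) = 0"
      "lie_inner (\<sigma>2 r) (F z) = leaf_height r"
    "lie_inner (F z) (\<sigma> r) = 0" "lie_inner (F z) (\<sigma>1 r) = 0" "lie_inner (\<sigma> r) (\<sigma> r) = 0"
    using sphere_perp[OF z] sphere1_perp_F[OF z] curvature_relation(3)[OF z]
        by (simp_all add: r lie_inner_commute)
  note perpG = leaf_tangent_perp[OF z, folded r] and perpV = leaf_acceleration_perp[OF z, folded r]
  note perpG' = perpG[unfolded lie_inner_commute[of "leaf_tangent z"]] and perpV'
      = perpV[unfolded lie_inner_commute[of "leaf_acceleration z"]]
  have GG: "lie_inner (leaf_tangent z) (leaf_tangent z) \<noteq> 0" using leaf_tangent_positive[OF z] by simp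
  have "R = 0"
  proof (rule orthogonal_to_basis_imp_zero)
    fix c1 c2 c3 c4 c5 c6
    assume "c1 *\<^sub>R F z + c2 *\<^sub>R p + c3 *\<^sub>R \<sigma> r + c4 *\<^sub>R \<sigma>1 r + c5 *\<^sub>R leaf_tangent z
        + c6 *\<^sub>R leaf_acceleration z = 0" (is "?S = 0")
    then have *: "lie_inner ?S y = 0" for y by (simp add: lie_simps)
    \<comment> \<open>The Gram matrix is triangular for a suitable order of the basis; this is the order of the steps.\<close>
    have "c6 = 0" using *[of "F z"] GG by (simp add: lie_simps contact_simps \<sigma>F perpG perpV)
    moreover from this have "c5 = 0" using *[of "leaf_tangent z"] GG
        by (simp add: lie_simps perpG perpG')
    moreover have "c1 = 0"
      using *[of "leaf_acceleration z"] GG calculation perpV' by (simp add: lie_simps)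
    moreover have "c2 = 0"
      using *[of "\<sigma> r"] Bnz calculation by (simp add: lie_simps \<sigma> \<sigma>1 \<sigma>F)
    moreover have "c4 = 0"
      using *[of "\<sigma>1 r"] nnz calculation by (simp add: lie_simps \<sigma>1)
    moreover have "c3 = 0"
      using *[of p] Bnz calculation by (simp add: lie_simps \<sigma>)
    ultimately show "c1 = 0 \<and> c2 = 0 \<and> c3 = 0 \<and> c4 = 0 \<and> c5 = 0 \<and> c6 = 0" by simp
  next
    show "lie_inner R (F z) = 0"
      by (simp add: R_def lie_simps \<sigma>F contact_simps coeff_q_def)
    show "lie_inner R p = 0"
      using Bnz by (simp add: R_def lie_simps \<sigma> contact_simps coeff_\<sigma>_def)
    show "lie_inner R (\<sigma> r) = 0"
      using Bnz by (simp add: R_def lie_simps \<sigma> \<sigma>1 \<sigma>2 \<sigma>F coeff_p_def)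
    show "lie_inner R (\<sigma>1 r) = 0"
      using nnz by (simp add: R_def lie_simps \<sigma>1 coeff_\<sigma>1_def)
    show "lie_inner R (leaf_tangent z) = 0" by (simp add: R_def lie_simps perpG')
    show "lie_inner R (leaf_acceleration z) = 0" by (simp add: R_def lie_simps perpV')
  qed
  then show ?thesis by (simp add: R_def)
qed

lemma continuous_coefficients:
  "continuous_on (u ` U) coeff_\<sigma>" "continuous_on (u ` U) coeff_\<sigma>1"
proof -
  note c = smooth_on_continuous_on[OF smooth_on_subset[OF _ u_J]]
  note cont_\<sigma> = c[OF smooth_\<sigma>] c[OF smooth_\<sigma>1] c[OF smooth_\<sigma>2]
  have cont: "continuous_on (u ` U) weight_f" "continuous_on (u ` U) weight_t"
      "continuous_on (u ` U) squared_speed"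
    unfolding weight_f_def weight_t_def squared_speed_def
        by (intro continuous_intros lie.continuous_on cont_\<sigma>)+
  have cont_Q: "continuous_on (u ` U) weingarten_form"
    unfolding weingarten_form_def by (intro continuous_intros cont)
  have nz: "\<forall>r\<in>u ` U. weight_t r \<noteq> 0" "\<forall>r\<in>u ` U. squared_speed r \<noteq> 0" "\<forall>r\<in>u ` U. weingarten_form r \<noteq> 0"
    using weight_t_nonzero curvature_relation(1,2) by fastforce+
  have cont_q: "continuous_on (u ` U) coeff_q"
    unfolding coeff_q_def leaf_height_def by (intro continuous_intros cont cont_Q nz)
  have cont_p: "continuous_on (u ` U) coeff_p"
    unfolding coeff_p_def by (intro continuous_intros cont cont_q nz)
  show cont_\<sigma>1: "continuous_on (u ` U) coeff_\<sigma>1"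
    unfolding coeff_\<sigma>1_def by (intro continuous_intros lie.continuous_on cont_\<sigma> cont cont_p cont_q nz)
  show "continuous_on (u ` U) coeff_\<sigma>"
    unfolding coeff_\<sigma>_def by (intro continuous_intros lie.continuous_on cont_\<sigma> cont cont_p cont_\<sigma>1 nz)
qed

text \<open>The function \<open>r \<mapsto> (e, \<sigma> r)\<close> solves the linear equation of \<open>sphere2_eq\<close>, in which \<open>p\<close> and \<open>q\<close>
  contribute nothing.\<close>

lemma sphere_perp_propagates:
  assumes U: "connected U" and z: "z0 \<in> U" "z \<in> U"
    and e: "lie_inner e p = 0" "lie_inner e q = 0"
    and e0: "lie_inner e (\<sigma> (u z0)) = 0" "lie_inner e (\<sigma>1 (u z0)) = 0"
  shows "lie_inner e (\<sigma> (u z)) = 0"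
proof (rule linear_second_order_ode_unique[where I = "u ` U" and ?r0.0 = "u z0" and ?y1.0
    = "\<lambda>r. lie_inner e (\<sigma>1 r)"
      and C = coeff_\<sigma> and E = coeff_\<sigma>1 and y = "\<lambda>r. lie_inner e (\<sigma> r)"])
  have "continuous_on U u" by (rule smooth_on_continuous_on[OF smooth_u])
  then show "connected (u ` U)" using U by (rule connected_continuous_image)
  fix s assume "s \<in> u ` U"
  then obtain y where y: "y \<in> U" "s = u y" by blast
  then have s: "s \<in> J" by (simp add: u_in_J)
  show "((\<lambda>r. lie_inner e (\<sigma> r)) has_real_derivative lie_inner e (\<sigma>1 s)) (at s)"
    using lie.has_vector_derivative[OF has_vector_derivative_const[of e] \<sigma>_derivative[OF s]]
    by (simp add: has_real_derivative_iff_has_vector_derivative lie_simps)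
  have "coeff_\<sigma> s * lie_inner e (\<sigma> s) + coeff_\<sigma>1 s * lie_inner e (\<sigma>1 s) = lie_inner e (\<sigma>2 s)"
    unfolding sphere2_eq[OF y] by (simp add: lie_simps e)
  then show "((\<lambda>r. lie_inner e (\<sigma>1 r)) has_real_derivative
      coeff_\<sigma> s * lie_inner e (\<sigma> s) + coeff_\<sigma>1 s * lie_inner e (\<sigma>1 s)) (at s)"
    using lie.has_vector_derivative[OF has_vector_derivative_const[of e] \<sigma>1_derivative[OF s]]
    by (simp add: has_real_derivative_iff_has_vector_derivative lie_simps)
qed (use assms continuous_coefficients in auto)

text \<open>A variant whose hypothesis does not mention the parametrization: orthogonality to the spheres near
  a single point. It is what passes from one chart to another.\<close>

lemma sphere_perp_germ_propagates:
  assumes U: "connected U" and z: "z0 \<in> U" "z \<in> U"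
    and e: "lie_inner e p = 0" "lie_inner e q = 0"
    and N: "open N" "z0 \<in> N" "\<And>y. y \<in> N \<Longrightarrow> y \<in> U \<Longrightarrow> lie_inner e (\<sigma> (u y)) = 0"
  shows "lie_inner e (\<sigma> (u z)) = 0"
proof (rule sphere_perp_propagates[OF U z e])
  show "lie_inner e (\<sigma> (u z0)) = 0" using N z by blast
  obtain v where v: "du z0 v \<noteq> 0" using du_nonzero[OF z(1)] by blast
  note s = has_derivative_curve_along[OF \<sigma>_derivative[OF u_in_J[OF z(1)]] u_derivative[OF z(1)]]
  have "lie_inner 0 (\<sigma> (u z0)) + lie_inner e (du z0 v *\<^sub>R \<sigma>1 (u z0)) = 0"
    by (rule differentiate_lie_inner[OF open_Int[OF N(1) open_U] _ has_derivative_const s has_derivative_const])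
      (use N z in auto)
  with v show "lie_inner e (\<sigma>1 (u z0)) = 0" by (simp add: lie_simps)
qed

lemma tangent_perp_proportional:
  assumes "z \<in> U" "lie_inner e (\<sigma> (u z)) = 0"
  shows "lie_inner e (T z) = - (weight_f (u z) / weight_t (u z)) * lie_inner e (F z)"
proof -
  have "weight_f (u z) * lie_inner e (F z) + weight_t (u z) * lie_inner e (T z) = 0"
    using assms(2) by (simp add: sphere_decomposition[OF assms(1)] lie_simps)
  with weight_t_nonzero[OF assms(1)] show ?thesis by (simp add: field_simps)
qed

text \<open>The velocity and acceleration of a leaf, orthonormalized as far as possible: the second vector may
  be spacelike, timelike or isotropic, which distinguishes elliptic, hyperbolic and parabolic
  rotations, but its product with \<open>F\<close> shows that it does not vanish.\<close>

lemma rotation_plane_exists: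
  assumes "connected U" "z \<in> U"
  shows "\<exists>e v. lie_inner e e = 1 \<and> lie_inner e v = 0 \<and> v \<noteq> 0 \<and>
    lie_inner e p = 0 \<and> lie_inner e q = 0 \<and> lie_inner v p = 0 \<and> lie_inner v q = 0 \<and>
    (\<forall>y\<in>U. lie_inner e (\<sigma> (u y)) = 0 \<and> lie_inner v (\<sigma> (u y)) = 0)"
proof -
  note z = assms(2)
  define r where "r = sqrt (lie_inner (leaf_tangent z) (leaf_tangent z))"
  have r: "r > 0" "r * r = lie_inner (leaf_tangent z) (leaf_tangent z)"
      using leaf_tangent_positive[OF z] by (simp_all add: r_def)
  define e where "e = (1 / r) *\<^sub>R leaf_tangent z"
  define v where "v = leaf_acceleration z - lie_inner (leaf_acceleration z) e *\<^sub>R e"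
  have ee: "lie_inner e e = 1" using r by (simp add: e_def lie_simps flip: r(2))
  have e: "lie_inner e p = 0" "lie_inner e q = 0" "lie_inner e (F z) = 0"
    "lie_inner e (\<sigma> (u z)) = 0" "lie_inner e (\<sigma>1 (u z)) = 0"
    by (simp_all add: e_def lie_simps leaf_tangent_perp[OF z])
  have v: "lie_inner v p = 0" "lie_inner v q = 0" "lie_inner v (F z) = - (r * r)"
    "lie_inner v (\<sigma> (u z)) = 0" "lie_inner v (\<sigma>1 (u z)) = 0" "lie_inner e v = 0"
    by (simp_all add: v_def lie_simps leaf_acceleration_perp[OF z] e r ee lie_inner_commute[of "leaf_acceleration z" e])
  have "v \<noteq> 0" using v(3) r(1) by (auto simp: lie.zero_left)
  moreover have "lie_inner e (\<sigma> (u y)) = 0" "lie_inner v (\<sigma> (u y)) = 0" if "y \<in> U" for y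
    using sphere_perp_propagates[OF assms that] e v by blast+
  ultimately show ?thesis using ee e v by blast
qed

end

section \<open>Rotations in a plane\<close>

definition skew_generator :: "real^6 \<Rightarrow> real^6 \<Rightarrow> real^6 \<Rightarrow> real^6" where
  "skew_generator e v x = lie_inner x v *\<^sub>R e - lie_inner x e *\<^sub>R v"

lemma bounded_linear_skew_generator: "bounded_linear (skew_generator e v)"
proof -
  have "bounded_linear (\<lambda>x. lie_inner x v *\<^sub>R e)" "bounded_linear (\<lambda>x. lie_inner x e *\<^sub>R v)"
    by (intro bounded_linear_scaleR_const lie.bounded_linear_left)+
  then show ?thesis
    unfolding skew_generator_def[abs_def] by (rule bounded_linear_sub)
qed

text \<open>Sine and versed sine, normalized so that all three signs of \<open>m\<close> are treated alike. If a linear map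
  satisfies \<open>X\<^sup>3 = - m X\<close>, then \<open>exp (t X) = 1 + S t X + C t X\<^sup>2\<close>.\<close>

definition sine_pair :: "real \<Rightarrow> (real \<Rightarrow> real) \<Rightarrow> (real \<Rightarrow> real) \<Rightarrow> bool" where
  "sine_pair m S C \<longleftrightarrow> S 0 = 0 \<and> C 0 = 0 \<and>
    (\<forall>s t. S (s + t) = S s + S t - m * (S s * C t + C s * S t)) \<and>
    (\<forall>s t. C (s + t) = C s + C t + S s * S t - m * (C s * C t)) \<and>
    (\<forall>t. (S has_real_derivative 1 - m * C t) (at t)) \<and>
    (\<forall>t. (C has_real_derivative S t) (at t)) \<and>
    (\<forall>t. (S t)\<^sup>2 = 2 * C t - m * (C t)\<^sup>2)"

lemma sine_pair_exists: "\<exists>S C. sine_pair m S C"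
proof -
  consider "m = 0" | k where "k > 0" "m = k\<^sup>2" | k where "k > 0" "m = - k\<^sup>2"
  proof (cases m "0::real" rule: linorder_cases)
    case less
    then show ?thesis using that(3)[of "sqrt (- m)"] by simp
  next
    case greater
    then show ?thesis using that(2)[of "sqrt m"] by simp
  qed (use that in blast)
  then show ?thesis
  proof cases
    case 1
    then have "sine_pair m (\<lambda>t. t) (\<lambda>t. t\<^sup>2 / 2)"
      unfolding sine_pair_def
      by (auto intro!: derivative_eq_intros simp: power2_eq_square field_simps)
    then show ?thesis by blast
  next
    case 2
    have "sine_pair m (\<lambda>t. sin (k * t) / k) (\<lambda>t. (1 - cos (k * t)) / k\<^sup>2)"
      unfolding sine_pair_def
    proof (intro conjI allI)
      fix s t
      show "sin (k * (s + t)) / k = sin (k * s) / k + sin (k * t) / k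
          - m * (sin (k * s) / k * ((1 - cos (k * t)) / k\<^sup>2) + (1
              - cos (k * s)) / k\<^sup>2 * (sin (k * t) / k))"
        using 2 by (simp add: distrib_left sin_add field_simps)
      show "(1 - cos (k * (s + t))) / k\<^sup>2 = (1 - cos (k * s)) / k\<^sup>2 + (1 - cos (k * t)) / k\<^sup>2
          + sin (k * s) / k * (sin (k * t) / k) - m * ((1 - cos (k * s)) / k\<^sup>2 * ((1
              - cos (k * t)) / k\<^sup>2))"
        using 2 by (simp add: distrib_left cos_add field_simps power2_eq_square)
      show "((\<lambda>t. sin (k * t) / k) has_real_derivative 1 - m * ((1 - cos (k * t)) / k\<^sup>2)) (at t)"
        using 2 by (auto intro!: derivative_eq_intros)
      show "((\<lambda>t. (1 - cos (k * t)) / k\<^sup>2) has_real_derivative sin (k * t) / k) (at t)"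
        using 2 by (auto intro!: derivative_eq_intros simp: power2_eq_square)
      show "(sin (k * t) / k)\<^sup>2 = 2 * ((1 - cos (k * t)) / k\<^sup>2) - m * ((1 - cos (k * t)) / k\<^sup>2)\<^sup>2"
        using 2 by (simp add: power_divide sin_squared_eq field_simps)
          (simp add: power2_eq_square algebra_simps)
    qed simp_all
    then show ?thesis by blast
  next
    case 3
    have "sine_pair m (\<lambda>t. sinh (k * t) / k) (\<lambda>t. (cosh (k * t) - 1) / k\<^sup>2)"
      unfolding sine_pair_def
    proof (intro conjI allI)
      fix s t
      show "sinh (k * (s + t)) / k = sinh (k * s) / k + sinh (k * t) / k
          - m * (sinh (k * s) / k * ((cosh (k * t) - 1) / k\<^sup>2) + (cosh (k * s)
              - 1) / k\<^sup>2 * (sinh (k * t) / k))"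
        using 3 by (simp add: distrib_left sinh_add field_simps)
      show "(cosh (k * (s + t)) - 1) / k\<^sup>2 = (cosh (k * s) - 1) / k\<^sup>2 + (cosh (k * t) - 1) / k\<^sup>2
          + sinh (k * s) / k * (sinh (k * t) / k) - m * ((cosh (k * s) - 1) / k\<^sup>2 * ((cosh (k * t)
              - 1) / k\<^sup>2))"
        using 3 by (simp add: distrib_left cosh_add field_simps power2_eq_square)
      show "((\<lambda>t. sinh (k * t) / k) has_real_derivative 1 - m * ((cosh (k * t) - 1) / k\<^sup>2)) (at t)"
        using 3 by (auto intro!: derivative_eq_intros)
      show "((\<lambda>t. (cosh (k * t) - 1) / k\<^sup>2) has_real_derivative sinh (k * t) / k) (at t)"
        using 3 by (auto intro!: derivative_eq_intros simp: power2_eq_square)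
      show "(sinh (k * t) / k)\<^sup>2 = 2 * ((cosh (k * t) - 1) / k\<^sup>2) - m * ((cosh (k * t) - 1) / k\<^sup>2)\<^sup>2"
        using 3 by (simp add: power_divide sinh_square_eq field_simps)
          (simp add: power2_eq_square algebra_simps)
    qed simp_all
    then show ?thesis by blast
  qed
qed

text \<open>On a plane with Gram matrix \<open>diag(1, m)\<close> the skew map \<open>X\<close> generated by the basis satisfies \<open>X\<^sup>3 = - m X\<close>,
  so its exponential is given by a sine pair for \<open>m = (v, v)\<close>.\<close>

lemma rotation_subgroup_exists:
  fixes e v p q :: "real^6"
  assumes ee: "lie_inner e e = 1" and ev: "lie_inner e v = 0" and v0: "v \<noteq> 0"
    and e: "lie_inner e p = 0" "lie_inner e q = 0" and v: "lie_inner v p = 0" "lie_inner v q = 0"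
  shows "\<exists>\<rho>. rotation_subgroup p q (span {e, v}) \<rho> \<and> \<rho> 0 = id \<and>
    (\<forall>x \<tau>. ((\<lambda>\<tau>. \<rho> \<tau> x) has_vector_derivative skew_generator e v (\<rho> \<tau> x)) (at \<tau>)) \<and>
    continuous_on UNIV (\<lambda>(\<tau>, x). \<rho> \<tau> x)"
proof -
  define m where "m = lie_inner v v"
  obtain S C where "sine_pair m S C" using sine_pair_exists by blast
  then have 0: "S 0 = 0" "C 0 = 0"
    and S_add: "S (s + t) = S s + S t - m * (S s * C t + C s * S t)"
    and C_add: "C (s + t) = C s + C t + S s * S t - m * (C s * C t)"
    and S': "(S has_real_derivative 1 - m * C t) (at t)"
    and C': "(C has_real_derivative S t) (at t)"
    and SC: "(S t)\<^sup>2 = 2 * C t - m * (C t)\<^sup>2" for s t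
    unfolding sine_pair_def by blast+
  let ?B = "skew_generator e v"
  let ?B2 = "\<lambda>x. - (lie_inner x v *\<^sub>R v) - (m * lie_inner x e) *\<^sub>R e"
  have ve: "lie_inner v e = 0" using ev by (simp add: lie_inner_commute)
  have B2: "?B (?B x) = ?B2 x" for x
    by (simp add: skew_generator_def lie_simps ee ev ve m_def)
  define \<rho> where "\<rho> \<tau> x = x + S \<tau> *\<^sub>R ?B x + C \<tau> *\<^sub>R ?B2 x" for \<tau> x
  have B\<rho>: "?B (\<rho> \<tau> x) = (1 - m * C \<tau>) *\<^sub>R ?B x + S \<tau> *\<^sub>R ?B2 x" for \<tau> x
    unfolding \<rho>_def skew_generator_def
    by (simp add: lie_simps ee ev ve m_def[symmetric] algebra_simps)
  have B2\<rho>: "?B2 (\<rho> \<tau> x) = - (m * S \<tau>) *\<^sub>R ?B x + (1 - m * C \<tau>) *\<^sub>R ?B2 x" for \<tau> x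
    unfolding \<rho>_def skew_generator_def
    by (simp add: lie_simps ee ev ve m_def[symmetric] algebra_simps)
  have deriv: "((\<lambda>\<tau>. \<rho> \<tau> x) has_vector_derivative ?B (\<rho> \<tau> x)) (at \<tau>)" for x \<tau>
    unfolding B\<rho> unfolding \<rho>_def using S'[of \<tau>] C'[of \<tau>]
    by (auto intro!: derivative_eq_intros)
  have cont1: "continuous_on UNIV S" "continuous_on UNIV C"
    using S' C' by (auto intro!: continuous_at_imp_continuous_on DERIV_isCont)
  have cont: "continuous_on UNIV (\<lambda>(\<tau>, x). \<rho> \<tau> x)"
    unfolding \<rho>_def skew_generator_def split_beta
    by (intro continuous_intros lie.continuous_on continuous_on_compose2[OF cont1(1)]
        continuous_on_compose2[OF cont1(2)]) auto
  have \<rho>0: "\<rho> 0 = id" by (rule ext) (simp add: \<rho>_def 0)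
  have fix_perp: "\<rho> \<tau> x = x" if "lie_inner x e = 0" "lie_inner x v = 0" for x \<tau>
    using that by (simp add: \<rho>_def skew_generator_def)
  have isometry: "space_form_isometry p q (\<rho> \<tau>)" for \<tau>
    unfolding space_form_isometry_def
  proof (intro conjI allI)
    show "linear (\<rho> \<tau>)"
      by (rule linearI) (simp_all add: \<rho>_def skew_generator_def lie_simps algebra_simps)
    show "\<rho> \<tau> p = p" "\<rho> \<tau> q = q"
      using e v by (auto intro!: fix_perp simp: lie_inner_commute)
    fix x y
    define X1 X2 Y1 Y2 where X: "X1 = lie_inner x e" "X2 = lie_inner x v" "Y1 = lie_inner y e"
        "Y2 = lie_inner y v"
    have c: "lie_inner e y = Y1" "lie_inner v y = Y2" by (simp_all add: X lie_inner_commute)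
    have "lie_inner (\<rho> \<tau> x) (\<rho> \<tau> y) = lie_inner x y
        + ((S \<tau>)\<^sup>2 - (2 * C \<tau> - m * (C \<tau>)\<^sup>2)) * (X2 * Y2 + m * (X1 * Y1))"
      unfolding \<rho>_def skew_generator_def
      by (simp add: lie_simps ee ev ve c m_def[symmetric] X[symmetric] algebra_simps power2_eq_square)
    then show "lie_inner (\<rho> \<tau> x) (\<rho> \<tau> y) = lie_inner x y" by (simp add: SC)
  qed
  have add: "\<rho> (s + t) = \<rho> s \<circ> \<rho> t" for s t
  proof
    fix x
    have "\<rho> s (\<rho> t x) = \<rho> t x + S s *\<^sub>R ?B (\<rho> t x) + C s *\<^sub>R ?B2 (\<rho> t x)" by (simp only: \<rho>_def[of s])
    also have "\<dots> = x + (S t + S s * (1 - m * C t) - C s * (m * S t)) *\<^sub>R ?B x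
        + (C t + S s * S t + C s * (1 - m * C t)) *\<^sub>R ?B2 x"
      unfolding B\<rho> B2\<rho> unfolding \<rho>_def
      by (simp add: algebra_simps)
    also have "\<dots> = \<rho> (s + t) x"
      unfolding \<rho>_def[of "s + t"] S_add C_add by (simp add: algebra_simps)
    finally show "\<rho> (s + t) x = (\<rho> s \<circ> \<rho> t) x" by simp
  qed
  \<comment> \<open>A trivial flow would have zero velocity, but \<open>X e = - v\<close>.\<close>
  have nontrivial: "\<exists>\<tau>. \<rho> \<tau> \<noteq> id"
  proof (rule ccontr)
    assume "\<not> (\<exists>\<tau>. \<rho> \<tau> \<noteq> id)"
    then have "(\<lambda>\<tau>. \<rho> \<tau> e) = (\<lambda>\<tau>. e)" by (intro ext) (metis id_apply)
    with deriv[of e 0] have "((\<lambda>\<tau>. e) has_vector_derivative ?B (\<rho> 0 e)) (at 0)" by simp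
    then have "?B (\<rho> 0 e) = 0"
      using has_vector_derivative_const[of e "at 0"] vector_derivative_unique_at by blast
    then show False using v0 by (simp add: \<rho>0 skew_generator_def ee ev)
  qed
  have "rotation_subgroup p q (span {e, v}) \<rho>"
    unfolding rotation_subgroup_def one_parameter_subgroup_def
  proof (intro conjI allI ballI)
    show "continuous_on UNIV (\<lambda>\<tau>. \<rho> \<tau> x)" for x
      using deriv has_vector_derivative_continuous by (blast intro: continuous_at_imp_continuous_on)
    show "\<rho> \<tau> x = x" if "x \<in> lie_perp (span {e, v})" for \<tau> x
      by (rule fix_perp) (use that in \<open>auto simp: lie_perp_def span_base\<close>)
  qed (use isometry \<rho>0 add nontrivial in blast)+
  with \<rho>0 deriv cont show ?thesis by blast
qed

lemma span_pair_plane: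
  assumes ee: "lie_inner e e = 1" and ev: "lie_inner e v = 0" and v0: "v \<noteq> 0"
    and e: "lie_inner e p = 0" "lie_inner e q = 0" and v: "lie_inner v p = 0" "lie_inner v q = 0"
  shows "dim (span {e, v}) = 2" "span {e, v} \<subseteq> lie_perp (span {p, q})"
proof -
  have "e \<notin> span {v}"
  proof
    assume "e \<in> span {v}"
    then obtain c where "e = c *\<^sub>R v" by (auto simp: span_singleton)
    then have "lie_inner e e = c * lie_inner e v" by (metis lie.scaleR_right real_scaleR_def)
    with ee ev show False by simp
  qed
  then have "independent {e, v}" "e \<noteq> v" using v0 by (auto simp: independent_insert span_base)
  then show "dim (span {e, v}) = 2" by (subst dim_span_eq_card_independent) auto
  show "span {e, v} \<subseteq> lie_perp (span {p, q})"
  proof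
    fix x assume "x \<in> span {e, v}"
    then obtain a b where "x = a *\<^sub>R e + b *\<^sub>R v" using in_span_pair by blast
    then have x: "lie_inner x p = 0" "lie_inner x q = 0" using e v by (simp_all add: lie_simps)
    have "lie_inner x y = 0" if "y \<in> span {p, q}" for y
    proof -
      from in_span_pair[OF that] obtain a b where "y = a *\<^sub>R p + b *\<^sub>R q" by blast
      then show ?thesis using x by (simp add: lie_simps)
    qed
    then show "x \<in> lie_perp (span {p, q})" by (simp add: lie_perp_def)
  qed
qed

section \<open>Surfaces tangent to a linear flow\<close>

context channel_patch
begin

lemma skew_generator_tangent:
  assumes z: "z \<in> U" and e: "lie_inner e p = 0" "lie_inner e q = 0" "lie_inner e (\<sigma> (u z)) = 0"
    and v: "lie_inner v p = 0" "lie_inner v q = 0" "lie_inner v (\<sigma> (u z)) = 0"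
  shows "\<exists>w. skew_generator e v (F z) = dF z w"
proof -
  interpret contact_element p q "F z" "T z" by (rule contact[OF z])
  show ?thesis
  proof (rule tangent_vectors_are_derivatives[OF linear_dF[OF z] inj_dF[OF z] dF_perp[OF z]])
    show "lie_inner (skew_generator e v (F z)) p = 0" "lie_inner (skew_generator e v (F z)) q = 0"
      by (simp_all add: skew_generator_def lie_simps e v)
    show "lie_inner (skew_generator e v (F z)) (F z) = 0"
      by (simp add: skew_generator_def lie_simps lie_inner_commute[of "F z"])
    show "lie_inner (skew_generator e v (F z)) (T z) = 0"
      using tangent_perp_proportional[OF z e(3)] tangent_perp_proportional[OF z v(3)]
      by (simp add: skew_generator_def lie_simps lie_inner_commute[of "F z"])
  qed
qed

end

text \<open>Invariance without integrating the tangent field on the surface. Let \<open>P\<close> be a linear left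
  inverse of the derivative of \<open>F\<close> at \<open>z0\<close>. Near \<open>z0\<close> the image of \<open>F\<close> is the graph of
  \<open>H = F \<circ> g\<close> with \<open>g\<close> a local inverse of \<open>P \<circ> F\<close>. For an orbit \<open>c\<close> of the flow the deviation
  \<open>d = c - H (P c)\<close> satisfies \<open>d' = X d - H' (P (X d))\<close>, because \<open>X (H y) = H' (P (X (H y)))\<close> by
  tangency; so \<open>d\<close> vanishes if it vanishes at time zero.\<close>

lemma flow_preserves_tangential_image:
  fixes F :: "real^2 \<Rightarrow> real^6" and X :: "real^6 \<Rightarrow> real^6"
  assumes D: "open D" "z0 \<in> D" and F: "smooth_on D F" and inj: "inj (frechet_derivative F (at z0))"
    and X: "bounded_linear X"
    and tangent: "\<And>z. z \<in> D \<Longrightarrow> \<exists>w. X (F z) = frechet_derivative F (at z) w"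
    and \<rho>0: "\<rho> 0 = id" and cont: "continuous_on UNIV (\<lambda>(\<tau>::real, x). \<rho> \<tau> x)"
    and \<rho>: "\<And>x \<tau>. ((\<lambda>\<tau>. \<rho> \<tau> x) has_vector_derivative X (\<rho> \<tau> x)) (at \<tau>)"
  shows "\<exists>N \<epsilon>. open N \<and> z0 \<in> N \<and> N \<subseteq> D \<and> \<epsilon> > 0 \<and>
    (\<forall>\<tau> z. \<bar>\<tau>\<bar> < \<epsilon> \<longrightarrow> z \<in> N \<longrightarrow> \<rho> \<tau> (F z) \<in> F ` D)"
proof -
  define F' where "F' z = Blinfun (frechet_derivative F (at z))" for z
  have dF: "(F has_derivative frechet_derivative F (at z)) (at z)" if "z \<in> D" for z
    by (rule smooth_on_has_derivative[OF F that])
  have F'_apply: "blinfun_apply (F' z) = frechet_derivative F (at z)" if "z \<in> D" for z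
    unfolding F'_def
        by (rule bounded_linear_Blinfun_apply) (rule has_derivative_bounded_linear[OF dF[OF that]])
  have contF': "continuous_on D F'"
  proof (rule continuous_on_blinfun_componentwise)
    fix i :: "real^2"
    have "continuous_on D (\<lambda>z. frechet_derivative F (at z) i)"
      by (rule smooth_on_continuous_on[OF smooth_on_frechet_derivative[OF F]])
    then show "continuous_on D (\<lambda>z. blinfun_apply (F' z) i)"
      by (rule continuous_on_eq) (simp add: F'_apply)
  qed
  obtain P0 :: "real^6 \<Rightarrow> real^2" where P0: "linear P0" "P0 \<circ> frechet_derivative F (at z0) = id"
    using linear_injective_left_inverse[OF has_derivative_linear[OF dF[OF D(2)]] inj] by blast
  define P where "P = Blinfun P0"
  have P: "blinfun_apply P = P0"
    unfolding P_def
        by (rule bounded_linear_Blinfun_apply) (simp add: P0 linear_conv_bounded_linear[symmetric])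
  have PF'z0: "P (F' z0 v) = v" for v
    using fun_cong[OF P0(2), of v] by (simp add: P F'_apply[OF D(2)])
  define \<eta> where "\<eta> = 1 / (2 * (norm P + 1))"
  have \<eta>: "\<eta> > 0" "norm P * \<eta> \<le> 1 / 2"
    by (simp_all add: \<eta>_def field_simps add_pos_nonneg)
  \<comment> \<open>On \<open>D'\<close> the derivative of \<open>P \<circ> F\<close> is within \<open>1/2\<close> of the identity, which bounds the derivative
    of the inverse by \<open>2\<close>.\<close>
  define D' where "D' = D \<inter> (\<lambda>z. norm (F' z - F' z0)) -` {..<\<eta>}"
  have "open D'"
    unfolding D'_def by (intro continuous_open_preimage continuous_intros contF' D)
  have D': "D' \<subseteq> D" "z0 \<in> D'" using D \<eta> by (auto simp: D'_def)
  have small: "norm (F' z v - F' z0 v) \<le> \<eta> * norm v" if "z \<in> D'" for z v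
  proof -
    have "norm ((F' z - F' z0) v) \<le> norm (F' z - F' z0) * norm v" by (rule norm_blinfun)
    also have "\<dots> \<le> \<eta> * norm v" using that by (intro mult_right_mono) (auto simp: D'_def)
    finally show ?thesis by (simp add: blinfun.diff_left)
  qed
  have expand: "norm v \<le> 2 * norm (P (F' z v))" if "z \<in> D'" for z v
  proof -
    have "norm (P (F' z v) - v) = norm (P (F' z v - F' z0 v))" by (simp add: blinfun.diff_right PF'z0)
    also have "\<dots> \<le> norm P * (\<eta> * norm v)"
      by (rule order_trans[OF norm_blinfun]) (intro mult_left_mono small that norm_ge_zero)
    also have "\<dots> \<le> 1 / 2 * norm v"
      using mult_right_mono[OF \<eta>(2), of "norm v"] by (simp add: mult.assoc)
    finally show ?thesis using norm_triangle_ineq2[of v "P (F' z v)"] by (simp add: norm_minus_commute)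
  qed
  define K where "K = norm (F' z0) + \<eta>"
  have K0: "K \<ge> 0" using \<eta> by (simp add: K_def)
  have K: "norm (F' z v) \<le> K * norm v" if "z \<in> D'" for z v
    using small[OF that, of v] norm_blinfun[of "F' z0" v] norm_triangle_ineq2[of "F' z v" "F' z0 v"]
    by (simp add: K_def distrib_right)
  have derPF: "((\<lambda>z. P (F z)) has_derivative blinfun_apply (P o\<^sub>L F' z)) (at z)" if "z \<in> D'" for z
  proof -
    have "z \<in> D" using that D' by blast
    from bounded_linear.has_derivative[OF blinfun.bounded_linear_right dF[OF this], of P]
    show ?thesis by (simp add: F'_apply \<open>z \<in> D\<close> o_def blinfun_compose.rep_eq)
  qed
  have contPF: "continuous_on D' (\<lambda>z. P o\<^sub>L F' z)"
    by (intro bounded_bilinear.continuous_on[OF bounded_bilinear_blinfun_compose] continuous_intros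
        continuous_on_subset[OF contF' D'(1)])
  have invPF: "id_blinfun o\<^sub>L (P o\<^sub>L F' z0) = id_blinfun"
    by (rule blinfun_eqI) (simp add: PF'z0)
  obtain U V g g' where UV: "open U" "U \<subseteq> D'" "z0 \<in> U" "open V" "P (F z0) \<in> V"
    and hom: "homeomorphism U V (\<lambda>z. P (F z)) g"
    and g: "\<And>y. y \<in> V \<Longrightarrow> (g has_derivative g' y) (at y)"
    and g': "\<And>y. y \<in> V \<Longrightarrow> g' y = inv (blinfun_apply (P o\<^sub>L F' (g y)))"
    and bij: "\<And>y. y \<in> V \<Longrightarrow> bij (blinfun_apply (P o\<^sub>L F' (g y)))"
    using inverse_function_theorem[OF \<open>open D'\<close> derPF contPF D'(2) invPF] by metis
  have gU: "g y \<in> U" if "y \<in> V" for y using hom that by (auto simp: homeomorphism_def)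
  have gD': "g y \<in> D'" "g y \<in> D" if "y \<in> V" for y using gU[OF that] UV(2) D'(1) by auto
  define H where "H y = F (g y)" for y
  define H' where "H' y w = F' (g y) (g' y w)" for y w
  have H: "(H has_derivative H' y) (at y)" if "y \<in> V" for y
    using diff_chain_at[OF g[OF that], of F "F' (g y)"] dF[OF gD'(2)[OF that]]
    by (simp add: H_def[abs_def] H'_def[abs_def] o_def F'_apply[OF gD'(2)[OF that]])
  have g'_right: "P (F' (g y) (g' y w)) = w" if "y \<in> V" for y w
    using bij_inv_eq_iff[OF bij[OF that]] g'[OF that] by (metis blinfun_apply_blinfun_compose)
  have g'_left: "g' y (P (F' (g y) w)) = w" if "y \<in> V" for y w
    using bij_inv_eq_iff[OF bij[OF that]] g'[OF that] by (metis blinfun_apply_blinfun_compose)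
  have H'_bound: "norm (H' y w) \<le> 2 * K * norm w" if "y \<in> V" for y w
  proof -
    have "norm (H' y w) \<le> K * norm (g' y w)" unfolding H'_def by (rule K[OF gD'(1)[OF that]])
    also have "\<dots> \<le> K * (2 * norm w)"
      using expand[OF gD'(1)[OF that], of "g' y w"] K0
          by (intro mult_left_mono) (simp_all add: g'_right[OF that])
    finally show ?thesis by simp
  qed
  have H'_tangent: "H' y (P (X (H y))) = X (H y)" if "y \<in> V" for y
  proof -
    note gy = gD'(2)[OF that]
    obtain w where "X (F (g y)) = F' (g y) w"
      using tangent[OF gy] F'_apply[OF gy] by metis
    then show ?thesis by (simp add: H_def H'_def g'_left[OF that])
  qed
  interpret X: bounded_linear X by (rule X)
  obtain KX where KX: "KX > 0" "\<And>x. norm (X x) \<le> norm x * KX" using X.pos_bounded by blast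
  define L where "L = KX + 2 * K * (norm P * KX)"

  have "continuous_on (UNIV \<times> D) (\<lambda>(\<tau>, z). P (\<rho> \<tau> (F z)))"
    unfolding split_beta
    by (intro bounded_linear.continuous_on[OF blinfun.bounded_linear_right]
        continuous_on_compose2[OF cont, of _ "\<lambda>x. (fst x, F (snd x))", simplified]
        continuous_intros continuous_on_compose2[OF smooth_on_continuous_on[OF F]]) auto
  then have "open ((UNIV \<times> D) \<inter> (\<lambda>(\<tau>, z). P (\<rho> \<tau> (F z))) -` V)"
    using D(1) UV(4) by (intro continuous_open_preimage open_Times) auto
  moreover have "(0, z0) \<in> (UNIV \<times> D) \<inter> (\<lambda>(\<tau>, z). P (\<rho> \<tau> (F z))) -` V"
    using D(2) UV(5) by (simp add: \<rho>0)
  ultimately obtain I N0 where IN: "open I" "open N0" "(0, z0) \<in> I \<times> N0"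
    "I \<times> N0 \<subseteq> (UNIV \<times> D) \<inter> (\<lambda>(\<tau>, z). P (\<rho> \<tau> (F z))) -` V"
    by (rule open_prod_elim)
  obtain \<epsilon> where \<epsilon>: "\<epsilon> > 0" "ball 0 \<epsilon> \<subseteq> I" using IN(1,3) by (auto elim: openE)
  show ?thesis
  proof (intro exI[of _ "N0 \<inter> U"] exI[of _ \<epsilon>] conjI allI impI)
    show "open (N0 \<inter> U)" "z0 \<in> N0 \<inter> U" "N0 \<inter> U \<subseteq> D" "\<epsilon> > 0"
      using IN UV D' \<epsilon> by auto
    fix \<tau> z assume \<tau>: "\<bar>\<tau>\<bar> < \<epsilon>" and z: "z \<in> N0 \<inter> U"
    define c where "c s = \<rho> s (F z)" for s
    define d where "d s = c s - H (P (c s))" for s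
    define d' where "d' s = X (d s) - H' (P (c s)) (P (X (d s)))" for s
    have inV: "P (c s) \<in> V" if "s \<in> closed_segment 0 \<tau>" for s
    proof -
      have "\<bar>s\<bar> < \<epsilon>" using that \<tau> by (auto simp: closed_segment_eq_real_ivl split: if_splits)
      then have "(s, z) \<in> I \<times> N0" using \<epsilon>(2) z by auto
      then show ?thesis using IN(4) by (auto simp: c_def)
    qed
    have d: "(d has_vector_derivative d' s) (at s)" if s: "s \<in> closed_segment 0 \<tau>" for s
    proof -
      have c: "(c has_vector_derivative X (c s)) (at s)" unfolding c_def by (rule \<rho>)
      have Pc: "((\<lambda>s. P (c s)) has_vector_derivative P (X (c s))) (at s)"
        by (rule bounded_linear.has_vector_derivative[OF blinfun.bounded_linear_right c])
      have lin: "linear (H' (P (c s)))" by (rule has_derivative_linear[OF H[OF inV[OF s]]])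
      have "((H \<circ> (\<lambda>s. P (c s))) has_vector_derivative H' (P (c s)) (P (X (c s)))) (at s)"
        by (rule vector_derivative_diff_chain_within[OF Pc]) (use H[OF inV[OF s]] has_derivative_at_withinI in blast)
      then have "(d has_vector_derivative X (c s) - H' (P (c s)) (P (X (c s)))) (at s)"
        unfolding d_def[abs_def] by (intro has_vector_derivative_diff c) (simp add: o_def)
      moreover have "d' s = X (c s) - H' (P (c s)) (P (X (c s)))"
        unfolding d'_def d_def X.diff blinfun.diff_right linear_diff[OF lin]
        using H'_tangent[OF inV[OF s]] by simp
      ultimately show ?thesis by simp
    qed
    have d'_bound: "norm (d' s) \<le> L * norm (d s)" if s: "s \<in> closed_segment 0 \<tau>" for s
    proof -
      have "norm (H' (P (c s)) (P (X (d s)))) \<le> 2 * K * norm (P (X (d s)))"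
          by (rule H'_bound[OF inV[OF s]])
      also have "\<dots> \<le> 2 * K * (norm P * (norm (d s) * KX))"
        using K0 by (intro mult_left_mono order_trans[OF norm_blinfun] KX) auto
      finally show ?thesis
        using KX(2)[of "d s"] norm_triangle_ineq4[of "X (d s)" "H' (P (c s)) (P (X (d s)))"]
        by (simp add: d'_def L_def algebra_simps)
    qed
    have "d \<tau> \<bullet> d \<tau> = 0"
    proof (rule gronwall_zero[where g = "\<lambda>s. d s \<bullet> d s" and L = "2 * L" and g'
        = "\<lambda>s. 2 * (d s \<bullet> d' s)"])
      fix s assume s: "s \<in> closed_segment 0 \<tau>"
      from bounded_bilinear.has_vector_derivative[OF bounded_bilinear_inner d[OF s] d[OF s]]
      show "((\<lambda>s. d s \<bullet> d s) has_real_derivative 2 * (d s \<bullet> d' s)) (at s)"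
        by (simp add: has_real_derivative_iff_has_vector_derivative inner_commute)
      have "\<bar>d s \<bullet> d' s\<bar> \<le> norm (d s) * norm (d' s)" by (rule Cauchy_Schwarz_ineq2)
      also have "\<dots> \<le> norm (d s) * (L * norm (d s))" by (intro mult_left_mono d'_bound s) auto
      finally show "\<bar>2 * (d s \<bullet> d' s)\<bar> \<le> 2 * L * (d s \<bullet> d s)"
        by (simp add: power2_norm_eq_inner[symmetric] power2_eq_square algebra_simps)
    next
      have "g (P (F z)) = z" using hom z by (auto simp: homeomorphism_def)
      then show "d 0 \<bullet> d 0 = 0" by (simp add: d_def c_def \<rho>0 H_def)
    qed auto
    then have "c \<tau> = F (g (P (c \<tau>)))" by (simp add: d_def H_def)
    moreover have "g (P (c \<tau>)) \<in> D" by (rule gD'(2)) (rule inV, simp)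
    ultimately show "\<rho> \<tau> (F z) \<in> F ` D" unfolding c_def by (metis image_eqI)
  qed
qed

section \<open>From charts to the surface\<close>

lemma chart_preimage_open:
  assumes M: "smooth_2_manifold M \<A>" and c: "(D, \<phi>) \<in> \<A>" and W: "openin M W"
  shows "open {z \<in> D. \<phi> z \<in> W}"
proof -
  have D: "open D" and hom: "homeomorphic_map (top_of_set D) (subtopology M (\<phi> ` D)) \<phi>"
    using M c by (auto simp: smooth_2_manifold_def)
  have "continuous_map (top_of_set D) M \<phi>"
    using homeomorphic_imp_continuous_map[OF hom] continuous_map_in_subtopology by blast
  from openin_continuous_map_preimage[OF this W] have "openin (top_of_set D) {z \<in> D. \<phi> z \<in> W}" by simp
  then show ?thesis using D openin_open_trans by blast
qed

lemma chart_image_open: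
  assumes M: "smooth_2_manifold M \<A>" and c: "(D, \<phi>) \<in> \<A>" and N: "open N" "N \<subseteq> D"
  shows "openin M (\<phi> ` N)"
proof -
  have D: "openin M (\<phi> ` D)" and hom: "homeomorphic_map (top_of_set D) (subtopology M (\<phi> ` D)) \<phi>"
    using M c by (auto simp: smooth_2_manifold_def)
  have "openin (top_of_set D) N" using N by (simp add: openin_subtopology) (metis Int_absorb2)
  then have "openin (subtopology M (\<phi> ` D)) (\<phi> ` N)"
    using homeomorphic_imp_open_map[OF hom] by (simp add: open_map_def)
  then show ?thesis using D by (rule openin_trans_full)
qed

lemma lie_inner_zero_cong_span:
  assumes "span {x} = span {y}"
  shows "lie_inner e x = 0 \<longleftrightarrow> lie_inner e y = 0"
proof -
  have "x \<in> span {y}" "y \<in> span {x}" using assms by (metis span_base singletonI)+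
  then show ?thesis by (auto simp: span_singleton lie_simps)
qed

text \<open>If a property has the same truth value at all points of suitable neighbourhoods, then the set where
  it holds and its complement are open.\<close>

lemma connected_space_local_to_global:
  assumes M: "connected_space M" and x0: "x0 \<in> topspace M" "Q x0" and x: "x \<in> topspace M"
    and loc: "\<And>x. x \<in> topspace M \<Longrightarrow> \<exists>N. openin M N \<and> x \<in> N \<and> (\<forall>y\<in>N. \<forall>y'\<in>N. Q y \<longrightarrow> Q y')"
  shows "Q x"
proof -
  let ?S = "{x \<in> topspace M. Q x}" and ?T = "{x \<in> topspace M. \<not> Q x}"
  have "openin M ?S"
  proof (subst openin_subopen, intro ballI)
    fix x assume "x \<in> ?S"
    then obtain N where "openin M N" "x \<in> N" "\<forall>y\<in>N. Q y" using loc[of x] by blast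
    moreover from this have "N \<subseteq> ?S" using openin_subset by fastforce
    ultimately show "\<exists>T. openin M T \<and> x \<in> T \<and> T \<subseteq> ?S" by blast
  qed
  moreover have "openin M ?T"
  proof (subst openin_subopen, intro ballI)
    fix x assume "x \<in> ?T"
    then obtain N where "openin M N" "x \<in> N" "\<forall>y\<in>N. \<not> Q y" using loc[of x] by blast
    moreover from this have "N \<subseteq> ?T" using openin_subset by fastforce
    ultimately show "\<exists>T. openin M T \<and> x \<in> T \<and> T \<subseteq> ?T" by blast
  qed
  ultimately have "?S = {} \<or> ?T = {}"
    using connected_spaceD[OF M, of ?S ?T] by blast
  then show ?thesis using x0 x by blast
qed

theorem theorem4p7:
  fixes p q :: "real^6"
    and M :: "'a topology" and \<A> :: "'a param set"
    and f t :: "'a \<Rightarrow> real^6"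
  assumes "point_sphere_complex p"
    and "space_form_vector p q"
    and "smooth_2_manifold M \<A>"
    and "connected_space M"
    and "surface_in_space_form p q M \<A> f"
    and "tangent_plane_congruence p q M \<A> f t"
    and "umbilic_free \<A> f t"
    and "channel_surface M \<A> f t"
    and "linear_weingarten \<A> f t"
    and "\<not> tubular \<A> f t"
  shows "rotational_surface p q M f"
proof -
  note M = assms(3)
  obtain s where s: "envelops M (legendre_lift f t) s" and family: "one_parameter_family \<A> s"
    using assms(8) by (auto simp: channel_surface_def)
  obtain a b c where abc: "weingarten_relation \<A> f t a b c"
    using assms(9) by (auto simp: linear_weingarten_def)
  with assms(10) have nt: "a * c - b\<^sup>2 \<noteq> 0" by (auto simp: tubular_def)
  have charts: "\<phi> z \<in> topspace M" if "(D, \<phi>) \<in> \<A>" "z \<in> D" for D \<phi> z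
    using M that by (auto simp: smooth_2_manifold_def)
  have covered: "\<exists>D \<phi> z. (D, \<phi>) \<in> \<A> \<and> z \<in> D \<and> x = \<phi> z" if "x \<in> topspace M" for x
  proof -
    have "x \<in> (\<Union>(D, \<phi>)\<in>\<A>. \<phi> ` D)" using M that by (auto simp: smooth_2_manifold_def)
    then show ?thesis by blast
  qed
  have contact: "contact_element p q (f x) (t x)" if "x \<in> topspace M" for x
  proof -
    have "f x \<in> space_form p q" using assms(5) that by (auto simp: surface_in_space_form_def)
    then show ?thesis
      using assms(1,2,6) that
      by unfold_locales (auto simp: space_form_def light_cone_def point_sphere_complex_def
          space_form_vector_def tangent_plane_congruence_def)
  qed

  have patch: "\<exists>U u J \<sigma>. z \<in> U \<and> open U \<and> U \<subseteq> D \<and> connected U \<and>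
      channel_patch p q U (f \<circ> \<phi>) (t \<circ> \<phi>) u J \<sigma> a b c \<and>
      (\<forall>y\<in>U. span {s (\<phi> y)} = span {\<sigma> (u y)})"
    if D: "(D, \<phi>) \<in> \<A>" and z: "z \<in> D" for D \<phi> z
  proof -
    from bspec[OF bspec[OF family[unfolded one_parameter_family_def] D, unfolded prod.case] z]
    obtain U' u J and \<sigma> :: "real \<Rightarrow> real^6" where U': "open U'" "z \<in> U'" "U' \<subseteq> D" "smooth_on U' u"
      "u ` U' \<subseteq> J" "smooth_on J \<sigma>" "\<forall>y\<in>U'. span {s (\<phi> y)} = span {\<sigma> (u y)}"
      by blast
    obtain \<epsilon> where \<epsilon>: "\<epsilon> > 0" "ball z \<epsilon> \<subseteq> U'" using U'(1,2) by (auto elim: openE)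
    define U where "U = ball z \<epsilon>"
    have U: "z \<in> U" "open U" "U \<subseteq> U'" "U \<subseteq> D" "connected U"
      using \<epsilon> U'(3) by (auto simp: U_def)
    have smooth: "smooth_on D (f \<circ> \<phi>)" "smooth_on D (t \<circ> \<phi>)"
      using assms(5,6) D
      by (auto simp: surface_in_space_form_def immersion_def smooth_map_def tangent_plane_congruence_def)
    have uU: "smooth_on U u" "u ` U \<subseteq> J" "smooth_on U (f \<circ> \<phi>)" "smooth_on U (t \<circ> \<phi>)"
      using smooth_on_subset U'(4) U(3,4) U'(5) smooth by blast+
    have "channel_patch p q U (f \<circ> \<phi>) (t \<circ> \<phi>) u J \<sigma> a b c"
    proof (rule channel_patch.intro)
      fix y assume y: "y \<in> U"
      then have yD: "y \<in> D" and top: "\<phi> y \<in> topspace M" using U(4) charts[OF D] by auto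
      show "contact_element p q ((f \<circ> \<phi>) y) ((t \<circ> \<phi>) y)" using contact[OF top] by simp
      show "lie_inner (frechet_derivative (f \<circ> \<phi>) (at y) v) ((t \<circ> \<phi>) y) = 0" for v
        using assms(6) D yD by (auto simp: tangent_plane_congruence_def)
      show "inj (frechet_derivative (f \<circ> \<phi>) (at y))"
        using assms(5) D yD by (auto simp: surface_in_space_form_def immersion_def)
      show "\<not> principal_curvatures (f \<circ> \<phi>) (t \<circ> \<phi>) y k k" for k
        using assms(7) D yD by (auto simp: umbilic_free_def)
      show "a * gauss_curvature (f \<circ> \<phi>) (t \<circ> \<phi>) y + 2 * b * mean_curvature (f \<circ> \<phi>) (t \<circ> \<phi>) y + c = 0"
        using abc D yD by (auto simp: weingarten_relation_def)
      have sy: "s (\<phi> y) \<noteq> 0" "s (\<phi> y) \<in> span {f (\<phi> y), t (\<phi> y)}"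
        using s top by (auto simp: envelops_def legendre_lift_def)
      have eq: "span {s (\<phi> y)} = span {\<sigma> (u y)}" using U'(7) U(3) y by blast
      have "\<sigma> (u y) \<in> span {s (\<phi> y)}" unfolding eq by (simp add: span_base)
      also have "\<dots> \<subseteq> span {f (\<phi> y), t (\<phi> y)}" using sy(2) by (simp add: span_minimal)
      finally show "\<sigma> (u y) \<in> span {(f \<circ> \<phi>) y, (t \<circ> \<phi>) y}" by simp
      show "\<sigma> (u y) \<noteq> 0"
      proof
        assume "\<sigma> (u y) = 0"
        then have "s (\<phi> y) \<in> {0}" using eq span_base[of "s (\<phi> y)" "{s (\<phi> y)}"] by simp
        with sy(1) show False by simp
      qed
    qed (rule U uU U' nt)+
    with U U'(7) show ?thesis by blast
  qed

  \<comment> \<open>Orthogonality to the germ of the sphere congruence at \<open>x\<close>. This refers to the spheres only through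
    \<open>s\<close>, so it is independent of charts and of the local curves \<open>\<sigma>\<close>.\<close>
  define perp where "perp e x \<longleftrightarrow> (\<exists>N. openin M N \<and> x \<in> N \<and> (\<forall>y\<in>N. lie_inner e (s y) = 0))" for e x
  have propagate: "\<exists>N. openin M N \<and> x \<in> N \<and> (\<forall>y\<in>N. \<forall>y'\<in>N. perp e y \<longrightarrow> perp e y')"
    if e: "lie_inner e p = 0" "lie_inner e q = 0" and x: "x \<in> topspace M" for e x
  proof -
    obtain D \<phi> z where D: "(D, \<phi>) \<in> \<A>" "z \<in> D" "x = \<phi> z" using covered[OF x] by blast
    obtain U u J \<sigma> where U: "z \<in> U" "open U" "U \<subseteq> D" "connected U"
      and cp: "channel_patch p q U (f \<circ> \<phi>) (t \<circ> \<phi>) u J \<sigma> a b c"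
      and \<sigma>: "\<forall>y\<in>U. span {s (\<phi> y)} = span {\<sigma> (u y)}"
      using patch[OF D(1,2)] by blast
    interpret channel_patch p q U "f \<circ> \<phi>" "t \<circ> \<phi>" u J \<sigma> a b c by (rule cp)
    have iff: "lie_inner e (s (\<phi> y)) = 0 \<longleftrightarrow> lie_inner e (\<sigma> (u y)) = 0" if "y \<in> U" for y
      using lie_inner_zero_cong_span \<sigma> that by blast
    have N: "openin M (\<phi> ` U)" by (rule chart_image_open[OF M D(1) U(2,3)])
    have "perp e (\<phi> y')" if y: "y \<in> U" "y' \<in> U" and pe: "perp e (\<phi> y)" for y y'
    proof -
      obtain N' where N': "openin M N'" "\<phi> y \<in> N'" "\<forall>x\<in>N'. lie_inner e (s x) = 0"
        using pe by (auto simp: perp_def)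
      have "lie_inner e (s (\<phi> w)) = 0" if w: "w \<in> U" for w
        unfolding iff[OF w]
      proof (rule sphere_perp_germ_propagates[OF U(4) y(1) w e])
        show "open {z \<in> D. \<phi> z \<in> N'}" by (rule chart_preimage_open[OF M D(1) N'(1)])
      qed (use N' y U iff in auto)
      then show ?thesis unfolding perp_def using N y(2) by blast
    qed
    then show ?thesis using N U(1) D(3) by blast
  qed

  \<comment> \<open>On the empty surface every equation is a Weingarten relation, so it is tubular.\<close>
  have "topspace M \<noteq> {}"
  proof
    assume "topspace M = {}"
    then have "\<forall>(D, \<phi>)\<in>\<A>. D = {}" using charts by fastforce
    then have "weingarten_relation \<A> f t 1 0 0" by (auto simp: weingarten_relation_def)
    then have "tubular \<A> f t" unfolding tubular_def by (intro exI[of _ 1] exI[of _ 0]) simp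
    with assms(10) show False ..
  qed
  then obtain x0 where x0: "x0 \<in> topspace M" by blast
  obtain e v where ev: "lie_inner e e = 1" "lie_inner e v = 0" "v \<noteq> 0"
    and e: "lie_inner e p = 0" "lie_inner e q = 0" and v: "lie_inner v p = 0" "lie_inner v q = 0"
    and perp0: "perp e x0" "perp v x0"
  proof -
    obtain D \<phi> z where D: "(D, \<phi>) \<in> \<A>" "z \<in> D" "x0 = \<phi> z" using covered[OF x0] by blast
    obtain U u J \<sigma> where U: "z \<in> U" "open U" "U \<subseteq> D" "connected U"
      and cp: "channel_patch p q U (f \<circ> \<phi>) (t \<circ> \<phi>) u J \<sigma> a b c"
      and \<sigma>: "\<forall>y\<in>U. span {s (\<phi> y)} = span {\<sigma> (u y)}"
      using patch[OF D(1,2)] by blast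
    obtain e v where ev: "lie_inner e e = 1 \<and> lie_inner e v = 0 \<and> v \<noteq> 0 \<and>
        lie_inner e p = 0 \<and> lie_inner e q = 0 \<and> lie_inner v p = 0 \<and> lie_inner v q = 0 \<and>
        (\<forall>y\<in>U. lie_inner e (\<sigma> (u y)) = 0 \<and> lie_inner v (\<sigma> (u y)) = 0)"
      using channel_patch.rotation_plane_exists[OF cp U(4,1)] by blast
    have N: "openin M (\<phi> ` U)" by (rule chart_image_open[OF M D(1) U(2,3)])
    have "\<forall>y\<in>\<phi> ` U. lie_inner e (s y) = 0" "\<forall>y\<in>\<phi> ` U. lie_inner v (s y) = 0"
      using ev \<sigma> lie_inner_zero_cong_span by blast+
    then have "perp e x0" "perp v x0"
      unfolding perp_def using N U(1) D(3) by blast+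
    with ev that show ?thesis by blast
  qed
  have perp: "lie_inner e (s x) = 0" "lie_inner v (s x) = 0" if x: "x \<in> topspace M" for x
  proof -
    have "perp e x" "perp v x"
      using connected_space_local_to_global[OF assms(4) x0 perp0(1) x propagate[OF e]]
        connected_space_local_to_global[OF assms(4) x0 perp0(2) x propagate[OF v]] by blast+
    then show "lie_inner e (s x) = 0" "lie_inner v (s x) = 0" by (auto simp: perp_def)
  qed

  have tangent: "\<exists>w. skew_generator e v ((f \<circ> \<phi>) z) = frechet_derivative (f \<circ> \<phi>) (at z) w"
    if D: "(D, \<phi>) \<in> \<A>" "z \<in> D" for D \<phi> z
  proof -
    obtain U u J \<sigma> where U: "z \<in> U"
      and cp: "channel_patch p q U (f \<circ> \<phi>) (t \<circ> \<phi>) u J \<sigma> a b c"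
      and \<sigma>: "\<forall>y\<in>U. span {s (\<phi> y)} = span {\<sigma> (u y)}"
      using patch[OF D] by blast
    have "lie_inner e (\<sigma> (u z)) = 0" "lie_inner v (\<sigma> (u z)) = 0"
      using perp[OF charts[OF D]] lie_inner_zero_cong_span \<sigma> U by blast+
    then show ?thesis by (rule channel_patch.skew_generator_tangent[OF cp U e _ v])
  qed

  obtain \<rho> where \<rho>: "rotation_subgroup p q (span {e, v}) \<rho>" "\<rho> 0 = id"
    "continuous_on UNIV (\<lambda>(\<tau>, x). \<rho> \<tau> x)"
    and flow: "\<And>x \<tau>. ((\<lambda>\<tau>. \<rho> \<tau> x) has_vector_derivative skew_generator e v (\<rho> \<tau> x)) (at \<tau>)"
    using rotation_subgroup_exists[OF ev e v] by blast
  have "invariant_under M f \<rho>"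
    unfolding invariant_under_def
  proof (intro allI impI, elim conjE)
    fix W x assume W: "openin M W" "x \<in> W"
    then obtain D \<phi> z where D: "(D, \<phi>) \<in> \<A>" "z \<in> D" "x = \<phi> z"
      using covered openin_subset by blast
    define D1 where "D1 = {z \<in> D. \<phi> z \<in> W}"
    have D1: "open D1" "z \<in> D1" "D1 \<subseteq> D"
      using chart_preimage_open[OF M D(1) W(1)] D W by (auto simp: D1_def)
    have imm: "smooth_on D (f \<circ> \<phi>)" "inj (frechet_derivative (f \<circ> \<phi>) (at z))"
      using assms(5) D by (auto simp: surface_in_space_form_def immersion_def smooth_map_def)
    have tangent1: "\<exists>w. skew_generator e v ((f \<circ> \<phi>) y) = frechet_derivative (f \<circ> \<phi>) (at y) w"
      if "y \<in> D1" for y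
      using tangent[OF D(1)] D1(3) that by blast
    obtain N \<epsilon> where N: "open N" "z \<in> N" "N \<subseteq> D1" "\<epsilon> > 0"
      "\<forall>\<tau> y. \<bar>\<tau>\<bar> < \<epsilon> \<longrightarrow> y \<in> N \<longrightarrow> \<rho> \<tau> ((f \<circ> \<phi>) y) \<in> (f \<circ> \<phi>) ` D1"
      using flow_preserves_tangential_image[OF D1(1,2) smooth_on_subset[OF imm(1) D1(3)] imm(2)
          bounded_linear_skew_generator tangent1 \<rho>(2,3) flow] by blast
    show "\<exists>U \<epsilon>. openin M U \<and> x \<in> U \<and> \<epsilon> > 0 \<and> (\<forall>\<tau>. \<bar>\<tau>\<bar> < \<epsilon> \<longrightarrow> \<rho> \<tau> ` f ` U \<subseteq> f ` W)"
    proof (intro exI[of _ "\<phi> ` N"] exI[of _ \<epsilon>] conjI allI impI)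
      show "openin M (\<phi> ` N)" using chart_image_open[OF M D(1) N(1)] N(3) D1(3) by blast
      show "x \<in> \<phi> ` N" using N(2) D(3) by blast
      fix \<tau> assume "\<bar>\<tau>\<bar> < \<epsilon>"
      with N(5) show "\<rho> \<tau> ` f ` \<phi> ` N \<subseteq> f ` W" by (fastforce simp: D1_def)
    qed (rule N(4))
  qed
  with \<rho>(1) span_pair_plane[OF ev e v] show ?thesis
    unfolding rotational_surface_def by (intro exI[of _ "span {e, v}"] exI[of _ \<rho>]) simp
qed

end
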